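(* Let $1/3<p<2/3$. Let $G_n$ be either a random graph drawn from $R(n,4)$, for each $n$, or any sequence of $4$-regular expander graphs whose girth tends to infinity. Choose the initial opinions $\{X_0(i)\}_{i\in V(G_n)}$ independently (and independently of $G_n$), each equal to $+1$ with probability $p$ and $-1$ with probability $1-p$, and let the opinions evolve by majority dynamics on $G_n$. Then, with high probability, unanimity is not reached at any time; that is, the probability that there exists $t\ge 0$ with $X_t(i)=X_t(j)$ for all $i,j\in V(G_n)$ tends to $0$ as $n\to\infty$.
   Context: $R(n,d)$ denotes the uniform distribution over all $d$-regular connected graphs with $n$ vertices. A sequence of $4$-regular graphs $G_n$ is a sequence of expanders if their sizes tend to infinity and their edge-isoperimetric (Cheeger) constants are bounded below by a positive constant independent of $n$. Majority dynamics on a graph $G=(V,E)$: for $t\in\{0,1,2,\dots\}$, $X_t(i)\in\{-1,+1\}$ is the opinion of vertex $i$ at time $t$, and $X_{t+1}(i)=\mathrm{sgn}\sum_{j\in\partial(i)}X_t(j)$, where $\partial(i)$ is the set of neighbors of $i$ together with $i$ itself if the degree of $i$ is even (so here, the degree being $4$, the majority is taken over the four neighbors and the vertex itself). Unanimity is reached at time $t$ when $X_t(i)=X_t(j)$ for all $i,j\in V$. "With high probability" means with probability tending to one as $n\to\infty$. *)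

theory Defs
  imports
    "HOL-Probability.Probability"
    "Graph_Theory.Graph_Theory"
begin

text \<open>
  A finite simple undirected graph is a \<open>pair_graph\<close>: finite, loop-free, without parallel arcs, and
  with a symmetric arc set, each edge \<open>{u, v}\<close> being represented by the two arcs \<open>(u, v)\<close>
  and \<open>(v, u)\<close>. Hence the out-degree is the usual degree.
\<close>

definition regular :: "nat \<Rightarrow> 'a pair_pre_digraph \<Rightarrow> bool" where
  "regular d G \<longleftrightarrow> pair_graph G \<and> (\<forall>v \<in> pverts G. out_degree (with_proj G) v = d)"

definition connected_regular_graphs :: "nat \<Rightarrow> nat \<Rightarrow> nat pair_pre_digraph set" where
  "connected_regular_graphs n d =
     {G. pverts G = {..<n} \<and> regular d G \<and> Digraph_Component.connected (with_proj G)}"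

lemma finite_connected_regular_graphs: "finite (connected_regular_graphs n d)"
proof (rule finite_subset)
  show "connected_regular_graphs n d \<subseteq>
      (\<lambda>A. \<lparr>pverts = {..<n}, parcs = A\<rparr>) ` Pow ({..<n} \<times> {..<n})"
  proof
    fix G assume G: "G \<in> connected_regular_graphs n d"
    then interpret pair_graph G
      by (simp add: connected_regular_graphs_def regular_def)
    have "parcs G \<in> Pow ({..<n} \<times> {..<n})"
      using G in_arcsD1 in_arcsD2 by (auto simp: connected_regular_graphs_def)
    moreover have "G = \<lparr>pverts = {..<n}, parcs = parcs G\<rparr>"
      using G by (simp add: connected_regular_graphs_def)
    ultimately show "G \<in> (\<lambda>A. \<lparr>pverts = {..<n}, parcs = A\<rparr>) ` Pow ({..<n} \<times> {..<n})"
      by blast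
  qed
qed simp

text \<open>
  Meaningful whenever \<open>connected_regular_graphs n d\<close> is nonempty; for \<open>d = 4\<close> this is the case
  for all \<open>n \<ge> 5\<close> (connect \<open>i\<close> to \<open>i \<plusminus> 1\<close> and \<open>i \<plusminus> 2\<close> modulo \<open>n\<close>).
\<close>

definition R :: "nat \<Rightarrow> nat \<Rightarrow> nat pair_pre_digraph pmf" where
  "R n d = pmf_of_set (connected_regular_graphs n d)"

text \<open>
  The library's \<open>cycle\<close> is a closed arc walk without repeated vertices. In a symmetric digraph
  this includes \<open>u \<rightarrow> v \<rightarrow> u\<close>, which is not a cycle of the undirected graph, whence the
  bound on the length. The girth of a forest is \<open>\<infinity>\<close>.
\<close>

definition girth :: "'a pair_pre_digraph \<Rightarrow> enat" where
  "girth G = (INF c \<in> {c. pre_digraph.cycle (with_proj G) c \<and> length c \<ge> 3}. enat (length c))"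

text \<open>Counts every boundary edge once, namely as the arc leaving \<open>S\<close>.\<close>

definition edge_boundary :: "'a pair_pre_digraph \<Rightarrow> 'a set \<Rightarrow> ('a \<times> 'a) set" where
  "edge_boundary G S = {(u, v) \<in> parcs G. u \<in> S \<and> v \<notin> S}"

text \<open>For finite graphs with at least two vertices (otherwise the infimum is over the empty set).\<close>

definition cheeger :: "'a pair_pre_digraph \<Rightarrow> real" where
  "cheeger G =
     (INF S \<in> {S. S \<subseteq> pverts G \<and> S \<noteq> {} \<and> 2 * card S \<le> card (pverts G)}.
        real (card (edge_boundary G S)) / real (card S))"

definition expander_sequence :: "nat \<Rightarrow> (nat \<Rightarrow> 'a pair_pre_digraph) \<Rightarrow> bool" where
  "expander_sequence d G \<longleftrightarrow>
     (\<forall>n. regular d (G n)) \<and>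
     filterlim (\<lambda>n. card (pverts (G n))) at_top sequentially \<and>
     (\<exists>c > 0. \<forall>n. cheeger (G n) \<ge> c)"

definition majority_nbhd :: "'a pair_pre_digraph \<Rightarrow> 'a \<Rightarrow> 'a set" where
  "majority_nbhd G i =
     {j. (i, j) \<in> parcs G} \<union> (if even (out_degree (with_proj G) i) then {i} else {})"

text \<open>Opinions are integers in \<open>{-1, 1}\<close>; the sum below has an odd number of terms.\<close>

primrec majority_dynamics :: "'a pair_pre_digraph \<Rightarrow> ('a \<Rightarrow> int) \<Rightarrow> nat \<Rightarrow> 'a \<Rightarrow> int" where
  "majority_dynamics G x 0 = x"
| "majority_dynamics G x (Suc t) =
     (\<lambda>i. sgn (\<Sum>j \<in> majority_nbhd G i. majority_dynamics G x t j))"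

definition unanimous :: "'a pair_pre_digraph \<Rightarrow> ('a \<Rightarrow> int) \<Rightarrow> bool" where
  "unanimous G x \<longleftrightarrow> (\<forall>i \<in> pverts G. \<forall>j \<in> pverts G. x i = x j)"

definition reaches_unanimity :: "'a pair_pre_digraph \<Rightarrow> ('a \<Rightarrow> int) \<Rightarrow> bool" where
  "reaches_unanimity G x \<longleftrightarrow> (\<exists>t. unanimous G (majority_dynamics G x t))"

text \<open>
  I.i.d. opinions on the finite set \<open>V\<close>; points outside \<open>V\<close> receive the irrelevant value \<open>1\<close>.
\<close>

definition initial_opinions :: "'a set \<Rightarrow> real \<Rightarrow> ('a \<Rightarrow> int) pmf" where
  "initial_opinions V p =
     Pi_pmf V 1 (\<lambda>_. map_pmf (\<lambda>b. if b then 1 else - 1) (bernoulli_pmf p))"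

end

theory Submission
  imports Defs
begin

text \<open>
  Call a nonempty vertex set a core if each of its vertices has two neighbours in it. If all
  opinions on a core of a 4-regular graph agree initially, they never change: every vertex of
  the core sees three equal votes among five, its own and those of two neighbours
  (\<open>core_persists\<close>). So it suffices to find, with high probability, a core of initial opinion
  \<open>+1\<close> and another of initial opinion \<open>-1\<close>. Since \<open>p\<close> and \<open>1 - p\<close> both exceed \<open>1/3\<close>, this
  follows from \<open>no_open_core_bound\<close>: in site percolation with a density above \<open>1 / (d - 1)\<close> on
  a \<open>d\<close>-regular graph with \<open>n\<close> vertices, where \<open>d \<ge> 3\<close>, the probability that there is no open
  core is at most \<open>K / n\<close>, where \<open>K\<close> depends only on \<open>d\<close> and the density. Both parts of the
  theorem follow from this uniform bound. For random graphs one only has to know, in addition,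
  that connected 4-regular graphs exist (\<open>circulant_connected_regular\<close>).

  The percolation bound is proved by comparing numbers of edges and vertices. Fix a depth \<open>s\<close>
  and consider the edges both of whose arcs can be continued to non-backtracking walks with
  \<open>s + 1\<close> open vertices, counted from the head of the arc on. If these edges outnumber the
  vertices on them, there is an open core (\<open>core_if_many_arcs\<close>). Let \<open>D v\<close> be the number of
  neighbours of an open vertex \<open>v\<close> through which open walks with \<open>s\<close> further vertices leave.
  Up to an error, the surplus of edges over vertices is half the sum of \<open>D v - 2\<close> over the
  open vertices with \<open>D v \<ge> 2\<close>, a sum that is at least the number of \<open>full\<close> vertices, those
  with \<open>D v = d\<close>. The error comes from the \<open>fading\<close> arcs, whose longest open walks have
  exactly \<open>s\<close> vertices (\<open>open_core_if_full_gt_fading\<close>).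

  If there is no core near a vertex \<open>v\<close>, the graph is a tree around \<open>v\<close>, and the relevant
  probabilities are those of a branching process with binomial offspring: if \<open>a r\<close> is the
  probability of survival for \<open>r\<close> generations, then \<open>v\<close> is full with probability
  \<open>p * (a s) ^ d\<close> and an arc at \<open>v\<close> fades with probability \<open>a s - a (s + 1)\<close>. As \<open>a\<close> decreases
  to a positive limit in the supercritical case, the former dominates for suitable \<open>s\<close>. Where
  instead a core lies near \<open>v\<close>, it has bounded size and is itself open with probability
  bounded below. Adding a large multiple of the indicator of this event gives a local \<open>score\<close>
  whose mean is bounded below by a positive constant at every vertex of every graph
  (\<open>expectation_score_ge\<close>), while a positive total score forces an open core. The total score
  changes by a bounded amount when one vertex changes its state, so it has variance \<open>O(n)\<close>
  (\<open>variance_Pi_pmf_le\<close>), and Chebyshev's inequality concludes.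
\<close>

section \<open>Independence and concentration for finite product distributions\<close>

text \<open>An event on configurations that is determined by the coordinates in \<open>A\<close>.\<close>

definition depends_on :: "'a set \<Rightarrow> (('a \<Rightarrow> 'b) \<Rightarrow> bool) \<Rightarrow> bool" where
  "depends_on A P \<longleftrightarrow> (\<forall>x y. (\<forall>i\<in>A. x i = y i) \<longrightarrow> P x = P y)"

lemma depends_onI: "(\<And>x y. (\<And>i. i \<in> A \<Longrightarrow> x i = y i) \<Longrightarrow> P x = P y) \<Longrightarrow> depends_on A P"
  unfolding depends_on_def by blast

lemma depends_onD: "depends_on A P \<Longrightarrow> (\<And>i. i \<in> A \<Longrightarrow> x i = y i) \<Longrightarrow> P x = P y"
  unfolding depends_on_def by blast

lemma depends_on_not: "depends_on A P \<Longrightarrow> depends_on A (\<lambda>x. \<not> P x)"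
  unfolding depends_on_def by blast

lemma depends_on_ball:
  "(\<And>j. j \<in> J \<Longrightarrow> depends_on (K j) (Q j)) \<Longrightarrow> depends_on (\<Union>j\<in>J. K j) (\<lambda>x. \<forall>j\<in>J. Q j x)"
  unfolding depends_on_def by (smt (verit) UN_I)

lemma depends_on_bex:
  "(\<And>j. j \<in> J \<Longrightarrow> depends_on (K j) (Q j)) \<Longrightarrow> depends_on (\<Union>j\<in>J. K j) (\<lambda>x. \<exists>j\<in>J. Q j x)"
  unfolding depends_on_def by (smt (verit) UN_I)

lemma prob_pair_pmf_Times:
  "measure_pmf.prob (pair_pmf M N) (A \<times> B) = measure_pmf.prob M A * measure_pmf.prob N B"
proof -
  have "measure_pmf.prob (pair_pmf M N) (A \<times> B)
      = measure_pmf.prob (pair_pmf M N) ((A \<times> B) \<inter> set_pmf (pair_pmf M N))"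
    by (rule measure_Int_set_pmf[symmetric])
  also have "(A \<times> B) \<inter> set_pmf (pair_pmf M N) = (A \<inter> set_pmf M) \<times> (B \<inter> set_pmf N)"
    by auto
  also have "measure_pmf.prob (pair_pmf M N) \<dots>
      = measure_pmf.prob M (A \<inter> set_pmf M) * measure_pmf.prob N (B \<inter> set_pmf N)"
    by (intro measure_pmf_prob_product) (auto intro: countable_subset[OF _ countable_set_pmf])
  finally show ?thesis
    by (simp add: measure_Int_set_pmf)
qed

lemma prob_Pi_pmf_conj:
  assumes V: "finite V" "A \<subseteq> V" and AB: "A \<inter> B = {}"
    and P: "depends_on A P" and Q: "depends_on B Q"
  shows "measure_pmf.prob (Pi_pmf V dflt q) {x. P x \<and> Q x}
       = measure_pmf.prob (Pi_pmf V dflt q) {x. P x} * measure_pmf.prob (Pi_pmf V dflt q) {x. Q x}"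
proof -
  let ?A = "Pi_pmf A dflt q" and ?B = "Pi_pmf (V - A) dflt q"
  have fin: "finite A" using V finite_subset by blast
  have split: "measure_pmf.prob (Pi_pmf V dflt q) {x. P x \<and> R x}
      = measure_pmf.prob ?A {x. P x} * measure_pmf.prob ?B {x. R x}"
    if P: "depends_on A P" and R: "depends_on B R" for P R
  proof -
    let ?h = "\<lambda>(f, g) x. if x \<in> A then f x else g x"
    have "Pi_pmf V dflt q = Pi_pmf (A \<union> (V - A)) dflt q"
      using V by (simp add: Un_absorb1)
    also have "\<dots> = map_pmf ?h (pair_pmf ?A ?B)"
      by (rule Pi_pmf_union) (use V fin in auto)
    finally have "measure_pmf.prob (Pi_pmf V dflt q) {x. P x \<and> R x}
        = measure_pmf.prob (pair_pmf ?A ?B) (?h -` {x. P x \<and> R x})"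
      by simp
    also have "?h -` {x. P x \<and> R x} = {x. P x} \<times> {x. R x}"
    proof -
      have "P (?h (f, g)) = P f" "R (?h (f, g)) = R g" for f g
        using AB by (auto intro!: depends_onD[OF P] depends_onD[OF R])
      then show ?thesis by auto
    qed
    finally show ?thesis
      by (simp add: prob_pair_pmf_Times)
  qed
  have T: "depends_on A (\<lambda>_. True)" "depends_on B (\<lambda>_. True)"
    by (auto simp: depends_on_def)
  show ?thesis
    using split[OF P Q] split[OF P T(2)] split[OF T(1) Q] by simp
qed

lemma prob_Pi_pmf_all:
  assumes V: "finite V" and J: "finite J" and K: "\<And>j. j \<in> J \<Longrightarrow> K j \<subseteq> V"
    and disj: "\<And>i j. i \<in> J \<Longrightarrow> j \<in> J \<Longrightarrow> i \<noteq> j \<Longrightarrow> K i \<inter> K j = {}"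
    and Q: "\<And>j. j \<in> J \<Longrightarrow> depends_on (K j) (Q j)"
  shows "measure_pmf.prob (Pi_pmf V dflt q) {x. \<forall>j\<in>J. Q j x}
       = (\<Prod>j\<in>J. measure_pmf.prob (Pi_pmf V dflt q) {x. Q j x})"
  using J K disj Q
proof (induction J)
  case (insert j J)
  have "measure_pmf.prob (Pi_pmf V dflt q) {x. Q j x \<and> (\<forall>j\<in>J. Q j x)}
      = measure_pmf.prob (Pi_pmf V dflt q) {x. Q j x}
        * measure_pmf.prob (Pi_pmf V dflt q) {x. \<forall>j\<in>J. Q j x}"
  proof (rule prob_Pi_pmf_conj[OF V])
    show "depends_on (\<Union>j\<in>J. K j) (\<lambda>x. \<forall>j\<in>J. Q j x)"
      using insert.prems by (intro depends_on_ball) auto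
    show "K j \<inter> (\<Union>j\<in>J. K j) = {}"
      using insert.prems(2)[of j] insert.hyps by auto
  qed (use insert.prems in auto)
  also have "measure_pmf.prob (Pi_pmf V dflt q) {x. \<forall>j\<in>J. Q j x}
      = (\<Prod>j\<in>J. measure_pmf.prob (Pi_pmf V dflt q) {x. Q j x})"
    by (rule insert.IH) (use insert.prems in auto)
  finally show ?case
    using insert.hyps by simp
qed simp

lemma expectation_pair_pmf_finite:
  fixes f :: "'a \<times> 'b \<Rightarrow> real"
  assumes "finite (set_pmf M)" "finite (set_pmf N)"
  shows "measure_pmf.expectation (pair_pmf M N) f
       = measure_pmf.expectation M (\<lambda>a. measure_pmf.expectation N (\<lambda>b. f (a, b)))"
proof -
  have "measure_pmf.expectation (pair_pmf M N) f
      = (\<Sum>z\<in>set_pmf M \<times> set_pmf N. pmf (pair_pmf M N) z *\<^sub>R f z)"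
    using assms by (intro integral_measure_pmf) auto
  also have "\<dots> = (\<Sum>a\<in>set_pmf M. \<Sum>b\<in>set_pmf N. pmf M a *\<^sub>R pmf N b *\<^sub>R f (a, b))"
    by (subst sum.cartesian_product) (auto intro!: sum.cong simp: pmf_pair)
  also have "\<dots> = (\<Sum>a\<in>set_pmf M. pmf M a *\<^sub>R measure_pmf.expectation N (\<lambda>b. f (a, b)))"
    using assms by (subst integral_measure_pmf[of "set_pmf N" N]) (auto simp: sum_distrib_left)
  also have "\<dots> = measure_pmf.expectation M (\<lambda>a. measure_pmf.expectation N (\<lambda>b. f (a, b)))"
    using assms by (intro integral_measure_pmf[symmetric]) auto
  finally show ?thesis .
qed

lemma finite_set_Pi_pmf:
  assumes "finite V" "finite (set_pmf q)"
  shows "finite (set_pmf (Pi_pmf V dflt (\<lambda>_. q)))"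
  using assms by (simp add: set_Pi_pmf finite_PiE_dflt)

text \<open>
  An inequality of Efron--Stein type: a function that moves by at most \<open>c\<close> when one coordinate is
  changed has variance at most \<open>c\<^sup>2\<close> per coordinate. Conditioning on one coordinate splits the
  variance into the conditional variance, bounded inductively, and the variance of the conditional
  mean, which itself moves by at most \<open>c\<close>.
\<close>

lemma variance_Pi_pmf_le:
  fixes f :: "('a \<Rightarrow> 'b) \<Rightarrow> real" and c :: real
  assumes V: "finite V" and q: "finite (set_pmf q)"
    and lip: "\<And>x i y. i \<in> V \<Longrightarrow> \<bar>f (x(i := y)) - f x\<bar> \<le> c"
  shows "measure_pmf.variance (Pi_pmf V dflt (\<lambda>_. q)) f \<le> card V * c\<^sup>2"
  using V lip
proof (induction V arbitrary: f)
  case (insert i V)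
  let ?P = "Pi_pmf V dflt (\<lambda>_. q)"
  have finP: "finite (set_pmf ?P)"
    by (rule finite_set_Pi_pmf[OF insert.hyps(1) q])
  have intP: "integrable (measure_pmf ?P) g" for g :: "_ \<Rightarrow> real"
    by (rule integrable_measure_pmf_finite[OF finP])
  have intq: "integrable (measure_pmf q) g" for g :: "_ \<Rightarrow> real"
    by (rule integrable_measure_pmf_finite[OF q])
  have E: "measure_pmf.expectation (Pi_pmf (insert i V) dflt (\<lambda>_. q)) g
      = measure_pmf.expectation q (\<lambda>y. measure_pmf.expectation ?P (\<lambda>x. g (x(i := y))))"
    for g :: "_ \<Rightarrow> real"
    using insert.hyps by (simp add: Pi_pmf_insert expectation_pair_pmf_finite[OF q finP])
  define m where "m y = measure_pmf.expectation ?P (\<lambda>x. f (x(i := y)))" for y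
  define M where "M = measure_pmf.expectation q m"
  have M: "M = measure_pmf.expectation (Pi_pmf (insert i V) dflt (\<lambda>_. q)) f"
    by (simp add: M_def m_def[abs_def] E)
  have m_lip: "\<bar>m y - m z\<bar> \<le> c" for y z
  proof -
    have "m y - m z = measure_pmf.expectation ?P (\<lambda>x. f (x(i := y)) - f (x(i := z)))"
      by (simp add: m_def intP)
    also have "\<bar>\<dots>\<bar> \<le> measure_pmf.expectation ?P (\<lambda>x. \<bar>f (x(i := y)) - f (x(i := z))\<bar>)"
      by (rule integral_abs_bound)
    also have "\<dots> \<le> measure_pmf.expectation ?P (\<lambda>x. c)"
    proof (rule integral_mono[OF intP intP])
      fix x
      show "\<bar>f (x(i := y)) - f (x(i := z))\<bar> \<le> c"
        using insert.prems[of i "x(i := z)" y] unfolding fun_upd_upd by blast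
    qed
    finally show ?thesis by simp
  qed
  have m_M: "\<bar>m y - M\<bar> \<le> c" for y
  proof -
    have "m y - M = measure_pmf.expectation q (\<lambda>z. m y - m z)"
      by (simp add: M_def intq)
    also have "\<bar>\<dots>\<bar> \<le> measure_pmf.expectation q (\<lambda>z. \<bar>m y - m z\<bar>)"
      by (rule integral_abs_bound)
    also have "\<dots> \<le> measure_pmf.expectation q (\<lambda>z. c)"
      by (rule integral_mono[OF intq intq m_lip])
    finally show ?thesis by simp
  qed
  have inner: "measure_pmf.expectation ?P (\<lambda>x. (f (x(i := y)) - M)\<^sup>2) \<le> card V * c\<^sup>2 + c\<^sup>2" for y
  proof -
    let ?g = "\<lambda>x. f (x(i := y))"
    have "measure_pmf.expectation ?P (\<lambda>x. (?g x - M)\<^sup>2)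
        = measure_pmf.expectation ?P (\<lambda>x. (?g x - m y)\<^sup>2 + (2 * (m y - M) * ?g x + (M\<^sup>2 - (m y)\<^sup>2)))"
      by (intro Bochner_Integration.integral_cong) (auto simp: power2_eq_square algebra_simps)
    also have "\<dots> = measure_pmf.expectation ?P (\<lambda>x. (?g x - m y)\<^sup>2)
        + (2 * (m y - M) * m y + (M\<^sup>2 - (m y)\<^sup>2))"
      using intP by (simp add: m_def)
    also have "2 * (m y - M) * m y + (M\<^sup>2 - (m y)\<^sup>2) = (m y - M)\<^sup>2"
      by (simp add: power2_eq_square algebra_simps)
    also have "measure_pmf.expectation ?P (\<lambda>x. (?g x - m y)\<^sup>2) \<le> card V * c\<^sup>2"
      unfolding m_def
    proof (rule insert.IH)
      fix x j z
      assume "j \<in> V"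
      with insert.hyps have swap: "x(j := z, i := y) = x(i := y, j := z)"
        by (intro fun_upd_twist) auto
      show "\<bar>f (x(j := z, i := y)) - f (x(i := y))\<bar> \<le> c"
        unfolding swap using \<open>j \<in> V\<close> by (intro insert.prems) simp
    qed
    also have "(m y - M)\<^sup>2 \<le> c\<^sup>2"
      using power_mono[OF m_M[of y], of 2] by simp
    finally show ?thesis by linarith
  qed
  have "measure_pmf.variance (Pi_pmf (insert i V) dflt (\<lambda>_. q)) f
      = measure_pmf.expectation q (\<lambda>y. measure_pmf.expectation ?P (\<lambda>x. (f (x(i := y)) - M)\<^sup>2))"
    unfolding M[symmetric] by (rule E)
  also have "\<dots> \<le> measure_pmf.expectation q (\<lambda>_. card V * c\<^sup>2 + c\<^sup>2)"
    by (rule integral_mono[OF intq intq inner])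
  also have "\<dots> = card (insert i V) * c\<^sup>2"
    using insert.hyps by (simp add: algebra_simps)
  finally show ?case .
qed simp

lemma prob_Pi_pmf_nonpos_le:
  fixes f :: "('a \<Rightarrow> 'b) \<Rightarrow> real" and c :: real
  assumes V: "finite V" and q: "finite (set_pmf q)"
    and lip: "\<And>x i y. i \<in> V \<Longrightarrow> \<bar>f (x(i := y)) - f x\<bar> \<le> c"
    and mean: "measure_pmf.expectation (Pi_pmf V dflt (\<lambda>_. q)) f \<ge> \<mu>" "\<mu> > 0"
  shows "measure_pmf.prob (Pi_pmf V dflt (\<lambda>_. q)) {x. f x \<le> 0} \<le> card V * c\<^sup>2 / \<mu>\<^sup>2"
proof -
  let ?P = "Pi_pmf V dflt (\<lambda>_. q)"
  have "measure_pmf.prob ?P {x. f x \<le> 0}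
      \<le> measure_pmf.prob ?P {x \<in> space (measure_pmf ?P). \<bar>f x - measure_pmf.expectation ?P f\<bar> \<ge> \<mu>}"
    by (rule measure_pmf.finite_measure_mono) (use mean in auto)
  also have "\<dots> \<le> measure_pmf.variance ?P f / \<mu>\<^sup>2"
    using mean finite_set_Pi_pmf[OF V q]
    by (intro measure_pmf.Chebyshev_inequality) (auto intro: integrable_measure_pmf_finite)
  also have "\<dots> \<le> card V * c\<^sup>2 / \<mu>\<^sup>2"
    by (intro divide_right_mono variance_Pi_pmf_le V q lip) auto
  finally show ?thesis .
qed

section \<open>Cores, non-backtracking walks and reachability\<close>

text \<open>
  A finite simple graph on \<open>V\<close> that is regular of degree \<open>d\<close>, presented by the neighbourhoods
  \<open>N v\<close>.
\<close>

locale regular_nbhds =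
  fixes V :: "'a set" and N :: "'a \<Rightarrow> 'a set" and d :: nat
  assumes finite_V: "finite V"
    and N_subset: "N v \<subseteq> V"
    and card_N: "v \<in> V \<Longrightarrow> card (N v) = d"
    and N_sym: "u \<in> N v \<Longrightarrow> v \<in> N u"
    and N_irrefl: "v \<notin> N v"
begin

lemma finite_N [simp]: "finite (N v)"
  using N_subset finite_V finite_subset by blast

text \<open>
  A core is a nonempty set in which every vertex has two neighbours. It contains a cycle, but
  cycles themselves are not needed.
\<close>

definition core :: "'a set \<Rightarrow> bool" where
  "core S \<longleftrightarrow> S \<noteq> {} \<and> (\<forall>z\<in>S. \<exists>a\<in>N z \<inter> S. \<exists>b\<in>N z \<inter> S. a \<noteq> b)"

lemma core_subset_V: "core S \<Longrightarrow> S \<subseteq> V"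
  unfolding core_def using N_subset N_sym by blast

text \<open>
  A graph with more edges than vertices contains a core (edges are counted twice, as arcs): in a
  minimal vertex set spanning more edges than it has vertices, no vertex has degree at most one,
  for deleting it would lose at most one edge.
\<close>

lemma core_if_many_arcs:
  assumes T: "finite T" and F: "F \<subseteq> T \<times> T" and FN: "\<And>u v. (u, v) \<in> F \<Longrightarrow> v \<in> N u"
    and sym: "\<And>u v. (u, v) \<in> F \<Longrightarrow> (v, u) \<in> F" and card: "card F > 2 * card T"
  shows "\<exists>S\<subseteq>T. core S"
proof -
  define dense where "dense S \<longleftrightarrow> S \<subseteq> T \<and> card (F \<inter> S \<times> S) > 2 * card S" for S
  have "F \<inter> T \<times> T = F" using F by blast
  then have "dense T" using card by (simp add: dense_def)
  then obtain S where S: "dense S" and min: "\<And>S'. dense S' \<Longrightarrow> card S \<le> card S'"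
    using ex_has_least_nat[of dense T card] by blast
  have finS: "finite S" using S T finite_subset by (auto simp: dense_def)
  have "S \<noteq> {}" using S by (auto simp: dense_def)
  moreover have "\<exists>a\<in>N z \<inter> S. \<exists>b\<in>N z \<inter> S. a \<noteq> b" if z: "z \<in> S" for z
  proof (rule ccontr)
    assume "\<not> ?thesis"
    then have "\<forall>a\<in>N z \<inter> S. \<forall>b\<in>N z \<inter> S. a = b" by blast
    then obtain w where w: "N z \<inter> S \<subseteq> {w}" by (cases "N z \<inter> S = {}") blast+
    have "F \<inter> S \<times> S \<subseteq> (F \<inter> (S - {z}) \<times> (S - {z})) \<union> {(z, w), (w, z)}"
    proof
      fix e assume e: "e \<in> F \<inter> S \<times> S"
      obtain a b where ab: "e = (a, b)" by (cases e)
      have "b \<in> N a" "a \<in> N b" using e ab FN sym by auto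
      then show "e \<in> (F \<inter> (S - {z}) \<times> (S - {z})) \<union> {(z, w), (w, z)}"
        using w e ab by auto
    qed
    then have "card (F \<inter> S \<times> S) \<le> card ((F \<inter> (S - {z}) \<times> (S - {z})) \<union> {(z, w), (w, z)})"
      using finS by (intro card_mono) auto
    also have "\<dots> \<le> card (F \<inter> (S - {z}) \<times> (S - {z})) + card {(z, w), (w, z)}"
      by (rule card_Un_le)
    also have "card {(z, w), (w, z)} \<le> 2" using card_length[of "[(z, w), (w, z)]"] by simp
    finally have "card (F \<inter> S \<times> S) \<le> card (F \<inter> (S - {z}) \<times> (S - {z})) + 2" by simp
    moreover have "card (S - {z}) = card S - 1" "card S > 0"
      using z finS by (auto simp: card_gt_0_iff)
    ultimately have "dense (S - {z})" using S by (auto simp: dense_def)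
    from min[OF this] show False
      using \<open>card (S - {z}) = card S - 1\<close> \<open>card S > 0\<close> by simp
  qed
  ultimately have "core S" by (auto simp: core_def)
  then show ?thesis using S by (auto simp: dense_def)
qed

text \<open>Non-backtracking walks, as lists of consecutive vertices.\<close>

fun nb_walk :: "'a list \<Rightarrow> bool" where
  "nb_walk (x # y # z # xs) \<longleftrightarrow> y \<in> N x \<and> x \<noteq> z \<and> nb_walk (y # z # xs)"
| "nb_walk [x, y] \<longleftrightarrow> y \<in> N x"
| "nb_walk _ \<longleftrightarrow> True"

lemma nb_walk_Cons:
  "nb_walk (x # y # xs) \<longleftrightarrow> y \<in> N x \<and> (xs \<noteq> [] \<longrightarrow> x \<noteq> hd xs) \<and> nb_walk (y # xs)"
  by (cases xs) auto

text \<open>Two walks from \<open>a\<close>, one of them reversed, are joined at \<open>a\<close>.\<close>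

lemma nb_walk_append:
  assumes "nb_walk (a # ys)" "nb_walk (a # zs)" "ys \<noteq> [] \<Longrightarrow> zs \<noteq> [] \<Longrightarrow> hd ys \<noteq> hd zs"
  shows "nb_walk (rev ys @ a # zs)"
  using assms
proof (induction ys arbitrary: a zs)
  case (Cons y ys)
  have "nb_walk (rev ys @ y # a # zs)"
    using Cons.prems N_sym[of y a] by (intro Cons.IH) (auto simp: nb_walk_Cons)
  then show ?case by simp
qed simp

lemma nb_walk_butlast: "nb_walk (xs @ [x]) \<Longrightarrow> nb_walk xs"
proof (induction xs)
  case (Cons a xs)
  then show ?case
    by (cases xs) (auto simp: nb_walk_Cons hd_append split: if_splits)
qed simp

lemma nb_walk_interior:
  assumes "nb_walk (x # ys @ [y])" "z \<in> set ys"
  shows "\<exists>a\<in>N z \<inter> set (x # ys @ [y]). \<exists>b\<in>N z \<inter> set (x # ys @ [y]). a \<noteq> b"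
  using assms
proof (induction ys arbitrary: x)
  case (Cons w ws)
  define v where "v = hd (ws @ [y])"
  have walk: "nb_walk (w # ws @ [y])" and w: "w \<in> N x" "x \<noteq> v"
    using Cons.prems by (auto simp: nb_walk_Cons v_def)
  have v: "v \<in> set (ws @ [y])" "v \<in> N w"
    using walk by (cases ws; auto simp: v_def nb_walk_Cons)+
  show ?case
  proof (cases "z \<in> set ws")
    case True
    then show ?thesis using Cons.IH[OF walk] by auto
  next
    case False
    then have "z = w" using Cons.prems by simp
    then show ?thesis using w v N_sym[of w x] by auto
  qed
qed simp

lemma core_if_closed_nb_walk:
  assumes "nb_walk xs" "length xs \<ge> 2" "hd xs = last xs"
  shows "\<exists>S\<subseteq>set xs. core S"
  using assms
proof (induction xs rule: length_induct)
  case (1 xs)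
  obtain x zs where "xs = x # zs" "zs \<noteq> []" using 1(3) by (cases xs; cases "tl xs") auto
  moreover obtain ys y where "zs = ys @ [y]" using \<open>zs \<noteq> []\<close> by (cases zs rule: rev_cases) auto
  ultimately have xs: "xs = x # ys @ [x]" using 1(4) by simp
  have "ys \<noteq> []" using 1(2) xs N_irrefl by auto
  then have ys: "hd ys \<in> N x" "nb_walk ys"
    using 1(2) xs nb_walk_butlast[of ys x] by (cases ys; auto simp: nb_walk_Cons)+
  have walk: "nb_walk (rev (x # ys @ [x]))"
    using 1(2) xs nb_walk_append[of x "ys @ [x]" "[]"] by simp
  then have last: "last ys \<in> N x"
    using \<open>ys \<noteq> []\<close> by (cases ys rule: rev_cases) (auto simp: nb_walk_Cons)
  show ?case
  proof (cases "hd ys = last ys")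
    case False
    have "core (set xs)"
      unfolding core_def
    proof (intro conjI ballI)
      fix z assume "z \<in> set xs"
      show "\<exists>a\<in>N z \<inter> set xs. \<exists>b\<in>N z \<inter> set xs. a \<noteq> b"
      proof (cases "z \<in> set ys")
        case True
        then show ?thesis using nb_walk_interior[of x ys x z] 1(2) xs by simp
      next
        case False
        then have "z = x" using \<open>z \<in> set xs\<close> xs by simp
        then show ?thesis
          using ys last \<open>hd ys \<noteq> last ys\<close> \<open>ys \<noteq> []\<close> xs
          by (intro bexI[of _ "hd ys"] bexI[of _ "last ys"]) auto
      qed
    qed (use xs in auto)
    then show ?thesis by blast
  next
    \<comment> \<open>The walk has a tail at its base vertex, which is cut off.\<close>
    case True
    have "length ys \<ge> 2"
    proof (rule ccontr)
      assume "\<not> length ys \<ge> 2"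
      then obtain y where "ys = [y]" using \<open>ys \<noteq> []\<close> by (cases ys; cases "tl ys") auto
      then show False using 1(2) xs by simp
    qed
    then have "\<exists>S\<subseteq>set ys. core S" using 1(1) ys True xs by auto
    then show ?thesis using xs by auto
  qed
qed

text \<open>
  The branch of depth \<open>r\<close> behind the arc from \<open>u\<close> to \<open>v\<close>: the vertices, from \<open>v\<close> on, that are
  visited by non-backtracking walks starting with this arc. If the graph looks like a tree here, it
  is the part of the tree hanging from \<open>v\<close>, seen from \<open>u\<close>, with \<open>r\<close> generations.
\<close>

primrec branch :: "nat \<Rightarrow> 'a \<Rightarrow> 'a \<Rightarrow> 'a set" where
  "branch 0 u v = {}"
| "branch (Suc r) u v = insert v (\<Union>w\<in>N v - {u}. branch r v w)"

text \<open>
  Some non-backtracking walk starting with the arc from \<open>u\<close> to \<open>v\<close> has its first \<open>r\<close> vertices from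
  \<open>v\<close> on in the set \<open>W\<close> of open vertices. For \<open>r > 0\<close> it is required to go on for one more step,
  which is possible in any case if \<open>d \<ge> 2\<close>.
\<close>

primrec reach :: "nat \<Rightarrow> 'a set \<Rightarrow> 'a \<Rightarrow> 'a \<Rightarrow> bool" where
  "reach 0 W u v \<longleftrightarrow> True"
| "reach (Suc r) W u v \<longleftrightarrow> v \<in> W \<and> (\<exists>w\<in>N v - {u}. reach r W v w)"

lemma reach_Suc_imp: "reach (Suc r) W u v \<Longrightarrow> reach r W u v"
  by (induction r arbitrary: u v) auto

lemma reach_cong: "W \<inter> branch r u v = W' \<inter> branch r u v \<Longrightarrow> reach r W u v = reach r W' u v"
proof (induction r arbitrary: u v)
  case (Suc r)
  have "reach r W v w = reach r W' v w" if "w \<in> N v - {u}" for w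
    using Suc.prems that by (intro Suc.IH) auto
  moreover have "v \<in> W \<longleftrightarrow> v \<in> W'" using Suc.prems by auto
  ultimately show ?case by (auto cong: bex_cong)
qed simp

lemma nb_walk_of_branch:
  assumes "z \<in> branch r u v" "v \<in> N u"
  shows "\<exists>xs. nb_walk (u # v # xs) \<and> last (v # xs) = z \<and> set (v # xs) \<subseteq> branch r u v"
  using assms
proof (induction r arbitrary: u v)
  case (Suc r)
  show ?case
  proof (cases "z = v")
    case True
    then show ?thesis using Suc.prems by (intro exI[of _ "[]"]) auto
  next
    case False
    then obtain w where w: "w \<in> N v - {u}" "z \<in> branch r v w" using Suc.prems by auto
    then obtain xs where "nb_walk (v # w # xs)" "last (w # xs) = z" "set (w # xs) \<subseteq> branch r v w"
      using Suc.IH by blast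
    then show ?thesis using w Suc.prems by (intro exI[of _ "w # xs"]) auto
  qed
qed simp

text \<open>
  Around a vertex without a nearby core the branches do not overlap: two walks leaving \<open>v\<close> through
  different neighbours and meeting again form a closed non-backtracking walk.
\<close>

lemma branch_disjoint:
  assumes nocore: "\<And>S. S \<subseteq> insert v (\<Union>w\<in>A. branch r v w) \<Longrightarrow> \<not> core S" and A: "A \<subseteq> N v"
  shows "w \<in> A \<Longrightarrow> v \<notin> branch r v w"
    and "w \<in> A \<Longrightarrow> w' \<in> A \<Longrightarrow> w \<noteq> w' \<Longrightarrow> branch r v w \<inter> branch r v w' = {}"
proof -
  assume w: "w \<in> A"
  show "v \<notin> branch r v w"
  proof
    assume "v \<in> branch r v w"
    then obtain xs where xs: "nb_walk (v # w # xs)" "last (w # xs) = v"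
        "set (w # xs) \<subseteq> branch r v w"
      using nb_walk_of_branch w A by blast
    then obtain S where "S \<subseteq> set (v # w # xs)" "core S"
      using core_if_closed_nb_walk[of "v # w # xs"] by auto
    then show False using nocore[of S] xs(3) w by auto
  qed
next
  assume w: "w \<in> A" "w' \<in> A" "w \<noteq> w'"
  show "branch r v w \<inter> branch r v w' = {}"
  proof (rule ccontr)
    assume "branch r v w \<inter> branch r v w' \<noteq> {}"
    then obtain z where z: "z \<in> branch r v w" "z \<in> branch r v w'" by auto
    obtain xs where xs: "nb_walk (v # w # xs)" "last (w # xs) = z"
        "set (w # xs) \<subseteq> branch r v w"
      using nb_walk_of_branch[OF z(1)] w A by blast
    obtain ys where ys: "nb_walk (v # w' # ys)" "last (w' # ys) = z"
        "set (w' # ys) \<subseteq> branch r v w'"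
      using nb_walk_of_branch[OF z(2)] w A by blast
    let ?c = "rev (w # xs) @ v # w' # ys"
    have "nb_walk ?c"
      using xs ys w by (intro nb_walk_append) auto
    moreover have "hd ?c = last (w # xs)" "last ?c = last (w' # ys)"
      by (simp_all only: hd_append hd_rev rev_is_Nil_conv) simp_all
    then have "hd ?c = last ?c" using xs(2) ys(2) by simp
    ultimately obtain S where "S \<subseteq> set ?c" "core S"
      using core_if_closed_nb_walk[of ?c] by auto
    moreover have "set ?c \<subseteq> insert v (\<Union>w\<in>A. branch r v w)"
      using xs(3) ys(3) w by auto
    ultimately show False using nocore[of S] by blast
  qed
qed

text \<open>
  The vertex \<open>v\<close> is open and open walks with \<open>s\<close> further vertices leave it through each of its
  neighbours.
\<close>

definition full :: "nat \<Rightarrow> 'a set \<Rightarrow> 'a \<Rightarrow> bool" where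
  "full s W v \<longleftrightarrow> v \<in> W \<and> (\<forall>w\<in>N v. reach s W v w)"

text \<open>
  The open walks starting with the arc from \<open>v\<close> to \<open>u\<close>, measured from \<open>u\<close> on, have at most \<open>s\<close>
  vertices, and this number is attained.
\<close>

definition fading :: "nat \<Rightarrow> 'a set \<Rightarrow> 'a \<Rightarrow> 'a \<Rightarrow> bool" where
  "fading s W v u \<longleftrightarrow> reach s W v u \<and> \<not> reach (Suc s) W v u"

text \<open>
  Consider the edges both of whose arcs satisfy \<open>reach (s + 1)\<close>. A vertex \<open>v\<close> on such an edge is
  open and satisfies \<open>reach s\<close> towards \<open>D v \<ge> 2\<close> of its neighbours; conversely, the
  arcs from such vertices that are counted in \<open>D v\<close> all belong to these edges, except for fading
  ones. As \<open>D v - 2 \<ge> 1\<close> at the full vertices, the edges outnumber the vertices.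
\<close>

lemma open_core_if_full_gt_fading:
  assumes d: "d \<ge> 3"
    and gt: "card {v \<in> V. full s W v} > (\<Sum>v\<in>V. card {u \<in> N v. fading s W v u})"
  shows "\<exists>S\<subseteq>W. core S"
proof -
  define D where "D v = {u \<in> N v. reach s W v u}" for v
  define T where "T = {v \<in> V. v \<in> W \<and> card (D v) \<ge> 2}"
  define F where "F = {(u, v). u \<in> N v \<and> reach (Suc s) W u v \<and> reach (Suc s) W v u}"
  define B where "B = (SIGMA v:V. {u \<in> N v. fading s W v u})"
  have finT: "finite T" using finite_V by (simp add: T_def)
  have T_I: "v \<in> T"
    if uv: "u \<in> N v" "reach (Suc s) W u v" "reach (Suc s) W v u" for u v
  proof -
    obtain w where "w \<in> N v - {u}" "reach s W v w" "v \<in> W" using uv(2) by auto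
    moreover have "reach s W v u" using uv(3) by (rule reach_Suc_imp)
    ultimately have "{u, w} \<subseteq> D v" "u \<noteq> w" using uv(1) by (auto simp: D_def)
    then have "card (D v) \<ge> 2"
      using card_mono[of "D v" "{u, w}"] by (simp add: D_def)
    moreover have "v \<in> V" using N_subset[of u] N_sym[OF uv(1)] by auto
    ultimately show ?thesis using \<open>v \<in> W\<close> by (simp add: T_def)
  qed
  have F_T: "F \<subseteq> T \<times> T"
  proof
    fix e assume "e \<in> F"
    then obtain u v where e: "e = (u, v)" "u \<in> N v" "v \<in> N u" "reach (Suc s) W u v"
        "reach (Suc s) W v u"
      using N_sym by (auto simp: F_def)
    show "e \<in> T \<times> T"
      unfolding e(1) using T_I[OF e(2,4,5)] T_I[OF e(3,5,4)] by blast
  qed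
  have "(SIGMA v:T. D v) \<subseteq> F \<union> B"
  proof
    fix e assume "e \<in> (SIGMA v:T. D v)"
    then obtain v u where e: "e = (v, u)" "v \<in> T" "u \<in> D v" by auto
    have "D v \<noteq> {} \<and> D v \<noteq> {u}" using e by (auto simp: T_def)
    then obtain w where "w \<in> D v" "w \<noteq> u" using e(3) by blast
    then have "reach (Suc s) W u v" using e by (auto simp: T_def D_def)
    moreover have "u \<in> N v" "v \<in> N u" "v \<in> V" "reach s W v u"
      using e N_sym by (auto simp: D_def T_def)
    ultimately show "e \<in> F \<union> B" using e by (auto simp: F_def B_def fading_def)
  qed
  moreover have "finite F" using F_T finT by (meson finite_SigmaI finite_subset)
  moreover have "finite B" using finite_V by (auto simp: B_def)
  ultimately have "card (SIGMA v:T. D v) \<le> card F + card B"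
    by (meson card_Un_le card_mono finite_UnI le_trans)
  moreover have "card (SIGMA v:T. D v) = (\<Sum>v\<in>T. card (D v))"
    using finT by (intro card_SigmaI) (auto simp: D_def)
  moreover have "card B = (\<Sum>v\<in>V. card {u \<in> N v. fading s W v u})"
    using finite_V unfolding B_def by (intro card_SigmaI) auto
  moreover have "2 * card T + card {v \<in> V. full s W v} \<le> (\<Sum>v\<in>T. card (D v))"
  proof -
    have full: "v \<in> T \<and> card (D v) = d" if "v \<in> V" "full s W v" for v
    proof -
      have "D v = N v" using that by (auto simp: D_def full_def)
      then show ?thesis using that d card_N by (auto simp: T_def full_def)
    qed
    then have "{v \<in> V. full s W v} \<subseteq> T" by auto
    then have "{v \<in> V. full s W v} = {v \<in> T. full s W v}" by (auto simp: T_def)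
    then have "2 * card T + card {v \<in> V. full s W v} = (\<Sum>v\<in>T. 2 + of_bool (full s W v))"
      unfolding sum.distrib using finT by (simp add: sum_of_bool_eq Int_def)
    also have "\<dots> \<le> (\<Sum>v\<in>T. card (D v))"
    proof (rule sum_mono)
      fix v assume "v \<in> T"
      then have "v \<in> V" "card (D v) \<ge> 2" by (auto simp: T_def)
      then show "2 + of_bool (full s W v) \<le> card (D v)"
        using full[of v] d by (cases "full s W v") auto
    qed
    finally show ?thesis .
  qed
  ultimately have "card F > 2 * card T" using gt by linarith
  moreover have "v \<in> N u" if "(u, v) \<in> F" for u v
    using that N_sym by (auto simp: F_def)
  moreover have "(v, u) \<in> F" if "(u, v) \<in> F" for u v
    using that N_sym by (auto simp: F_def)
  ultimately obtain S where "S \<subseteq> T" "core S"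
    using core_if_many_arcs[OF finT F_T] by blast
  moreover have "T \<subseteq> W" by (auto simp: T_def)
  ultimately show ?thesis by blast
qed

text \<open>The vertices at distance at most \<open>r\<close> from \<open>v\<close>.\<close>

primrec ball :: "nat \<Rightarrow> 'a \<Rightarrow> 'a set" where
  "ball 0 v = {v}"
| "ball (Suc r) v = (\<Union>w\<in>insert v (N v). ball r w)"

lemma ball_Suc_right: "ball (Suc r) v = (\<Union>w\<in>ball r v. insert w (N w))"
proof (induction r arbitrary: v)
  case (Suc r)
  have "ball (Suc (Suc r)) v = (\<Union>w\<in>insert v (N v). ball (Suc r) w)" by simp
  also have "\<dots> = (\<Union>w\<in>insert v (N v). \<Union>x\<in>ball r w. insert x (N x))" unfolding Suc.IH ..
  also have "\<dots> = (\<Union>w\<in>ball (Suc r) v. insert w (N w))" by simp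
  finally show ?case .
qed auto

lemma ball_refl: "v \<in> ball r v"
  by (induction r) auto

lemma ball_sym: "w \<in> ball r v \<Longrightarrow> v \<in> ball r w"
proof (induction r arbitrary: v w)
  case (Suc r)
  then obtain u where u: "u \<in> ball r v" "w \<in> insert u (N u)"
    unfolding ball_Suc_right by blast
  then show ?case using Suc.IH[of u v] N_sym[of w u] by auto
qed auto

lemma ball_subset_V: "v \<in> V \<Longrightarrow> ball r v \<subseteq> V"
proof (induction r arbitrary: v)
  case (Suc r)
  have "ball r w \<subseteq> V" if "w \<in> insert v (N v)" for w
    using Suc that N_subset[of v] by blast
  then show ?case unfolding ball.simps by blast
qed simp

lemma finite_ball: "finite (ball r v)"
  by (induction r arbitrary: v) auto

lemma card_ball_le: "v \<in> V \<Longrightarrow> card (ball r v) \<le> (d + 1) ^ r"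
proof (induction r arbitrary: v)
  case (Suc r)
  have "card (ball (Suc r) v) \<le> (\<Sum>w\<in>insert v (N v). card (ball r w))"
    unfolding ball.simps by (intro card_UN_le) auto
  also have "\<dots> \<le> (\<Sum>w\<in>insert v (N v). (d + 1) ^ r)"
    using Suc N_subset[of v] by (intro sum_mono) auto
  also have "\<dots> = (d + 1) ^ Suc r"
    using Suc.prems N_irrefl card_N by simp
  finally show ?case .
qed simp

lemma branch_subset_ball: "branch r u v \<subseteq> ball r v"
proof (induction r arbitrary: u v)
  case (Suc r)
  show ?case using Suc.IH ball_refl[of v r] by fastforce
qed simp

end

section \<open>Open cores in supercritical percolation\<close>

text \<open>
  The probability that, in site percolation on a tree where every vertex has \<open>k\<close> children, an open
  path with \<open>r\<close> vertices starts at the root.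
\<close>

primrec survival :: "real \<Rightarrow> nat \<Rightarrow> nat \<Rightarrow> real" where
  "survival p k 0 = 1"
| "survival p k (Suc r) = p * (1 - (1 - survival p k r) ^ k)"

lemma survival_bounds:
  assumes "0 \<le> p" "p \<le> 1"
  shows "0 \<le> survival p k r \<and> survival p k r \<le> 1"
proof (induction r)
  case (Suc r)
  then have "0 \<le> (1 - survival p k r) ^ k" "(1 - survival p k r) ^ k \<le> 1"
    by (auto intro: power_le_one)
  then show ?case
    using assms by (auto intro!: mult_nonneg_nonneg mult_le_one)
qed simp

lemma survival_decreasing:
  assumes "0 \<le> p" "p \<le> 1"
  shows "survival p k (Suc r) \<le> survival p k r"
proof (induction r)
  case 0
  then show ?case using survival_bounds[OF assms, of k 1] by simp
next
  case (Suc r)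
  have "(1 - survival p k r) ^ k \<le> (1 - survival p k (Suc r)) ^ k"
    using Suc survival_bounds[OF assms, of k r] by (intro power_mono) auto
  then show ?case
    using assms by (auto intro!: mult_left_mono)
qed

text \<open>
  By Bernoulli's inequality the recursion maps the value \<open>p - 1 / k\<close> to a value that is not smaller,
  so the survival probability stays above it.
\<close>

lemma survival_ge:
  assumes p: "p \<le> 1" "p * real k > 1"
  shows "survival p k r \<ge> p - 1 / k"
proof -
  define a where "a = p - 1 / k"
  have k: "k > 0" using p by (cases k) auto
  have "0 \<le> p"
  proof (rule ccontr)
    assume "\<not> 0 \<le> p"
    then have "p * real k \<le> 0" by (intro mult_nonpos_nonneg) auto
    then show False using p by simp
  qed
  have "a \<le> p" by (simp add: a_def)
  then have "a \<le> 1" using p by linarith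
  moreover have "0 < a" "1 + k * a = p * k"
    using p k by (simp_all add: a_def field_simps)
  ultimately have a: "0 < a" "a \<le> 1" "1 + k * a = p * k" by blast+
  have "(1 - a) ^ k * (1 + k * a) \<le> (1 - a) ^ k * (1 + a) ^ k"
    using a by (intro mult_left_mono Bernoulli_inequality) auto
  also have "\<dots> = (1 - a\<^sup>2) ^ k"
    by (simp add: power_mult_distrib[symmetric] power2_eq_square algebra_simps)
  also have "\<dots> \<le> 1"
    using a by (intro power_le_one) (auto simp: power_le_one)
  finally have *: "(1 - a) ^ k * (p * k) \<le> 1" using a by simp
  have fix_le: "a \<le> p * (1 - (1 - a) ^ k)"
    using * k by (simp add: a_def field_simps)
  have "a \<le> survival p k r"
  proof (induction r)
    case (Suc r)
    have "(1 - survival p k r) ^ k \<le> (1 - a) ^ k"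
      using Suc survival_bounds[OF \<open>0 \<le> p\<close> p(1), of k r] by (intro power_mono) auto
    then have "p * (1 - (1 - a) ^ k) \<le> survival p k (Suc r)"
      using \<open>0 \<le> p\<close> by (auto intro!: mult_left_mono)
    then show ?case using fix_le by linarith
  qed (use a in simp)
  then show ?thesis by (simp add: a_def)
qed

lemma survival_drop_small:
  assumes "0 \<le> p" "p \<le> 1" "\<epsilon> > 0"
  shows "\<exists>s. survival p k s - survival p k (Suc s) < \<epsilon>"
proof -
  have "decseq (survival p k)"
    using survival_decreasing[OF assms(1,2)] by (intro decseq_SucI)
  then obtain L where L: "survival p k \<longlonglongrightarrow> L"
    using decseq_convergent[of "survival p k" 0] survival_bounds[OF assms(1,2)] by metis
  have "(\<lambda>s. survival p k s - survival p k (Suc s)) \<longlonglongrightarrow> L - L"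
    by (intro tendsto_diff L LIMSEQ_Suc)
  then have "eventually (\<lambda>s. survival p k s - survival p k (Suc s) < \<epsilon>) sequentially"
    using assms(3) by (intro order_tendstoD(2)) auto
  then show ?thesis by (auto simp: eventually_sequentially)
qed

text \<open>
  Site percolation: independent states with law \<open>q\<close> on the vertices, a vertex being open if its
  state satisfies \<open>is_open\<close>.
\<close>

locale site_percolation = regular_nbhds V N d
  for V :: "'a set" and N :: "'a \<Rightarrow> 'a set" and d :: nat +
  fixes q :: "'b pmf" and is_open :: "'b \<Rightarrow> bool" and dflt :: 'b
  assumes finite_q: "finite (set_pmf q)"
begin

abbreviation config :: "('a \<Rightarrow> 'b) pmf" where
  "config \<equiv> Pi_pmf V dflt (\<lambda>_. q)"

abbreviation Pr :: "(('a \<Rightarrow> 'b) \<Rightarrow> bool) \<Rightarrow> real" where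
  "Pr Q \<equiv> measure_pmf.prob config {x. Q x}"

text \<open>The density of open vertices, and the set of open vertices of a configuration.\<close>

definition p :: real where
  "p = measure_pmf.prob q {y. is_open y}"

definition W :: "('a \<Rightarrow> 'b) \<Rightarrow> 'a set" where
  "W x = {i. is_open (x i)}"

lemma p_bounds: "0 \<le> p" "p \<le> 1"
  by (auto simp: p_def)

lemma depends_on_W:
  assumes "\<And>x y. W x \<inter> A = W y \<inter> A \<Longrightarrow> Q x = Q y"
  shows "depends_on A Q"
proof (rule depends_onI)
  fix x y :: "'a \<Rightarrow> 'b" assume "\<And>i. i \<in> A \<Longrightarrow> x i = y i"
  then show "Q x = Q y" by (intro assms) (auto simp: W_def)
qed

lemma Pr_not: "Pr (\<lambda>x. \<not> Q x) = 1 - Pr Q"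
  using measure_pmf.prob_compl[of "{x. Q x}" config] by (simp add: set_diff_eq)

lemma Pr_open: "v \<in> V \<Longrightarrow> Pr (\<lambda>x. v \<in> W x) = p"
proof -
  assume v: "v \<in> V"
  have "map_pmf (\<lambda>x. x v) config = q"
    using v finite_V by (simp add: Pi_pmf_component)
  then have "p = measure_pmf.prob (map_pmf (\<lambda>x. x v) config) {y. is_open y}"
    by (simp add: p_def)
  then show ?thesis by (simp add: W_def vimage_def)
qed

lemma branch_subset_V: "v \<in> V \<Longrightarrow> branch r u v \<subseteq> V"
  using branch_subset_ball ball_subset_V by blast

lemma depends_on_reach: "depends_on (branch r u v) (\<lambda>x. reach r (W x) u v)"
  by (intro depends_on_W reach_cong)

lemma depends_on_open: "depends_on {v} (\<lambda>x. v \<in> W x)"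
  by (intro depends_on_W) auto

text \<open>Where branches do not overlap, events on different branches are independent.\<close>

lemma Pr_branches:
  assumes v: "v \<in> V" and A: "A \<subseteq> N v"
    and nocore: "\<And>S. S \<subseteq> insert v (\<Union>w\<in>A. branch r v w) \<Longrightarrow> \<not> core S"
    and Q: "\<And>w. w \<in> A \<Longrightarrow> depends_on (branch r v w) (Q w)"
    and prob: "\<And>w. w \<in> A \<Longrightarrow> Pr (Q w) = a"
  shows "Pr (\<lambda>x. v \<in> W x \<and> (\<forall>w\<in>A. Q w x)) = p * a ^ card A"
    and "Pr (\<lambda>x. v \<in> W x \<and> (\<exists>w\<in>A. Q w x)) = p * (1 - (1 - a) ^ card A)"
proof -
  let ?B = "\<Union>w\<in>A. branch r v w"
  have finA: "finite A" using finite_subset[OF A] by simp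
  have AV: "w \<in> V" if "w \<in> A" for w using that A N_subset[of v] by auto
  note disj = branch_disjoint[OF nocore A]
  have vB: "{v} \<inter> ?B = {}" using disj(1) by auto
  have all: "Pr (\<lambda>x. \<forall>w\<in>A. R w x) = b ^ card A"
    if "\<And>w. w \<in> A \<Longrightarrow> depends_on (branch r v w) (R w)" "\<And>w. w \<in> A \<Longrightarrow> Pr (R w) = b" for R b
  proof -
    have "Pr (\<lambda>x. \<forall>w\<in>A. R w x) = (\<Prod>w\<in>A. Pr (R w))"
      by (intro prob_Pi_pmf_all[where K = "branch r v"] finite_V finA that(1) disj(2)
          branch_subset_V AV)
    then show ?thesis using that(2) by simp
  qed
  have "Pr (\<lambda>x. v \<in> W x \<and> (\<forall>w\<in>A. Q w x)) = Pr (\<lambda>x. v \<in> W x) * Pr (\<lambda>x. \<forall>w\<in>A. Q w x)"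
    using v vB
    by (intro prob_Pi_pmf_conj[where A = "{v}" and B = ?B] finite_V depends_on_open depends_on_ball Q) auto
  then show "Pr (\<lambda>x. v \<in> W x \<and> (\<forall>w\<in>A. Q w x)) = p * a ^ card A"
    using all[OF Q prob] Pr_open[OF v] by simp
  have "Pr (\<lambda>x. v \<in> W x \<and> (\<exists>w\<in>A. Q w x)) = Pr (\<lambda>x. v \<in> W x) * Pr (\<lambda>x. \<exists>w\<in>A. Q w x)"
    using v vB
    by (intro prob_Pi_pmf_conj[where A = "{v}" and B = ?B] finite_V depends_on_open depends_on_bex Q) auto
  moreover have "Pr (\<lambda>x. \<exists>w\<in>A. Q w x) = 1 - Pr (\<lambda>x. \<forall>w\<in>A. \<not> Q w x)"
    using Pr_not[of "\<lambda>x. \<forall>w\<in>A. \<not> Q w x"] by simp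
  moreover have "Pr (\<lambda>x. \<forall>w\<in>A. \<not> Q w x) = (1 - a) ^ card A"
    by (intro all depends_on_not Q) (simp_all add: Pr_not prob)
  ultimately show "Pr (\<lambda>x. v \<in> W x \<and> (\<exists>w\<in>A. Q w x)) = p * (1 - (1 - a) ^ card A)"
    using Pr_open[OF v] by simp
qed

lemma Pr_reach:
  assumes "v \<in> N u" "\<And>S. S \<subseteq> branch r u v \<Longrightarrow> \<not> core S"
  shows "Pr (\<lambda>x. reach r (W x) u v) = survival p (d - 1) r"
  using assms
proof (induction r arbitrary: u v)
  case (Suc r)
  have v: "v \<in> V" using Suc.prems N_subset by auto
  have "u \<in> N v" using Suc.prems N_sym by auto
  then have card: "card (N v - {u}) = d - 1" using card_N[OF v] by simp
  have "Pr (\<lambda>x. reach r (W x) v w) = survival p (d - 1) r" if w: "w \<in> N v - {u}" for w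
  proof (rule Suc.IH)
    show "\<not> core S" if "S \<subseteq> branch r v w" for S
      using that w by (intro Suc.prems(2)) auto
  qed (use w in auto)
  then have "Pr (\<lambda>x. v \<in> W x \<and> (\<exists>w\<in>N v - {u}. reach r (W x) v w))
      = p * (1 - (1 - survival p (d - 1) r) ^ card (N v - {u}))"
    by (intro Pr_branches(2)[where r = r] v depends_on_reach Suc.prems(2)) auto
  then show ?case by (simp only: reach.simps survival.simps card)
qed simp

lemma Pr_full:
  assumes v: "v \<in> V" and nocore: "\<And>S. S \<subseteq> insert v (\<Union>w\<in>N v. branch s v w) \<Longrightarrow> \<not> core S"
  shows "Pr (\<lambda>x. full s (W x) v) = p * survival p (d - 1) s ^ d"
proof -
  have "Pr (\<lambda>x. reach s (W x) v w) = survival p (d - 1) s" if w: "w \<in> N v" for w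
    using w by (intro Pr_reach nocore) auto
  then have "Pr (\<lambda>x. v \<in> W x \<and> (\<forall>w\<in>N v. reach s (W x) v w))
      = p * survival p (d - 1) s ^ card (N v)"
    by (intro Pr_branches(1)[where r = s] v order_refl depends_on_reach nocore) auto
  then show ?thesis by (simp only: full_def card_N[OF v])
qed

lemma Pr_fading:
  assumes u: "u \<in> N v" and nocore: "\<And>S. S \<subseteq> branch (Suc s) v u \<Longrightarrow> \<not> core S"
    and nocore': "\<And>S. S \<subseteq> branch s v u \<Longrightarrow> \<not> core S"
  shows "Pr (\<lambda>x. fading s (W x) v u) = survival p (d - 1) s - survival p (d - 1) (Suc s)"
proof -
  have "Pr (\<lambda>x. fading s (W x) v u)
      = measure_pmf.prob config ({x. reach s (W x) v u} - {x. reach (Suc s) (W x) v u})"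
    by (simp add: fading_def set_diff_eq)
  also have "\<dots> = Pr (\<lambda>x. reach s (W x) v u) - Pr (\<lambda>x. reach (Suc s) (W x) v u)"
    by (rule measure_pmf.finite_measure_Diff) (auto dest: reach_Suc_imp simp del: reach.simps)
  also have "Pr (\<lambda>x. reach s (W x) v u) = survival p (d - 1) s"
    by (intro Pr_reach u nocore')
  also have "Pr (\<lambda>x. reach (Suc s) (W x) v u) = survival p (d - 1) (Suc s)"
    by (intro Pr_reach u nocore)
  finally show ?thesis .
qed

lemma Pr_all_open: "S \<subseteq> V \<Longrightarrow> Pr (\<lambda>x. S \<subseteq> W x) = p ^ card S"
proof -
  assume S: "S \<subseteq> V"
  have "Pr (\<lambda>x. \<forall>v\<in>S. v \<in> W x) = (\<Prod>v\<in>S. Pr (\<lambda>x. v \<in> W x))"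
    using S finite_subset[OF S finite_V]
    by (intro prob_Pi_pmf_all[where K = "\<lambda>v. {v}"] finite_V depends_on_open) auto
  also have "\<dots> = (\<Prod>v\<in>S. p)"
    using S by (intro prod.cong) (auto simp: Pr_open)
  finally show ?thesis by (simp add: subset_eq)
qed

text \<open>
  The local contribution of a vertex to a count which can only be positive if there is an open
  core. Where the graph looks like a tree, the first two terms have positive mean. Elsewhere a core
  is nearby, which is open with probability bounded below, and the last term compensates for the
  possibly negative rest if the weight \<open>C\<close> is large.
\<close>

definition score :: "nat \<Rightarrow> real \<Rightarrow> ('a \<Rightarrow> 'b) \<Rightarrow> 'a \<Rightarrow> real" where
  "score s C x v = of_bool (full s (W x) v) - (\<Sum>u\<in>N v. of_bool (fading s (W x) v u))
     + C * of_bool (\<exists>S\<subseteq>W x \<inter> ball (Suc (Suc s)) v. core S)"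

lemma open_core_if_score_pos:
  assumes "d \<ge> 3" "(\<Sum>v\<in>V. score s C x v) > 0"
  shows "\<exists>S\<subseteq>W x. core S"
proof (rule ccontr)
  assume nocore: "\<not> ?thesis"
  then have "score s C x v = of_bool (full s (W x) v) - (\<Sum>u\<in>N v. of_bool (fading s (W x) v u))" for v
    by (auto simp: score_def)
  then have "(\<Sum>v\<in>V. score s C x v)
      = real (card {v \<in> V. full s (W x) v}) - real (\<Sum>v\<in>V. card {u \<in> N v. fading s (W x) v u})"
    using finite_V by (simp add: sum_subtractf sum_of_bool_eq Int_def)
  then have "card {v \<in> V. full s (W x) v} > (\<Sum>v\<in>V. card {u \<in> N v. fading s (W x) v u})"
    using assms(2) by linarith
  then show False using open_core_if_full_gt_fading[OF assms(1)] nocore by blast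
qed

lemma score_local:
  assumes "W x \<inter> ball (Suc (Suc s)) v = W y \<inter> ball (Suc (Suc s)) v"
  shows "score s C x v = score s C y v"
proof -
  have sub: "branch (Suc s) v u \<subseteq> ball (Suc (Suc s)) v" "branch s v u \<subseteq> ball (Suc (Suc s)) v"
    if "u \<in> N v" for u
  proof -
    have 1: "ball (Suc s) u \<subseteq> ball (Suc (Suc s)) v" using that unfolding ball.simps(2)[of "Suc s"] by blast
    have 2: "ball s u \<subseteq> ball (Suc s) u" unfolding ball_Suc_right by blast
    show "branch (Suc s) v u \<subseteq> ball (Suc (Suc s)) v" "branch s v u \<subseteq> ball (Suc (Suc s)) v"
      using branch_subset_ball[of "Suc s" v u] branch_subset_ball[of s v u] 1 2 by blast+
  qed
  have r1: "reach (Suc s) (W x) v u = reach (Suc s) (W y) v u" if "u \<in> N v" for u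
    using sub(1)[OF that] assms by (intro reach_cong) blast
  have r2: "reach s (W x) v u = reach s (W y) v u" if "u \<in> N v" for u
    using sub(2)[OF that] assms by (intro reach_cong) blast
  have "v \<in> ball (Suc (Suc s)) v" by (rule ball_refl)
  then have v: "v \<in> W x \<longleftrightarrow> v \<in> W y" using assms by blast
  have "full s (W x) v = full s (W y) v" using v r2 by (simp add: full_def)
  moreover have "fading s (W x) v u = fading s (W y) v u" if "u \<in> N v" for u
    unfolding fading_def r1[OF that] r2[OF that] ..
  ultimately show ?thesis using assms by (simp add: score_def cong: sum.cong)
qed

lemma score_range:
  assumes "C \<ge> 0" "v \<in> V"
  shows "- real d \<le> score s C x v \<and> score s C x v \<le> 1 + C"
proof -
  have "(\<Sum>u\<in>N v. of_bool (fading s (W x) v u)) \<le> (\<Sum>u\<in>N v. 1 :: real)"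
    by (intro sum_mono) auto
  then have "(\<Sum>u\<in>N v. of_bool (fading s (W x) v u)) \<le> real d"
    using card_N[OF assms(2)] by simp
  moreover have "0 \<le> (\<Sum>u\<in>N v. of_bool (fading s (W x) v u) :: real)"
    by (intro sum_nonneg) auto
  ultimately show ?thesis using assms(1) by (auto simp: score_def)
qed

text \<open>Only the scores of the vertices near \<open>i\<close> are affected by a change at \<open>i\<close>.\<close>

lemma sum_score_lipschitz:
  assumes C: "C \<ge> 0" and i: "i \<in> V"
  shows "\<bar>(\<Sum>v\<in>V. score s C (x(i := y)) v) - (\<Sum>v\<in>V. score s C x v)\<bar>
       \<le> real ((d + 1) ^ (s + 2)) * (real d + 1 + C)"
proof -
  let ?B = "ball (Suc (Suc s))"
  let ?\<Delta> = "\<lambda>v. \<bar>score s C (x(i := y)) v - score s C x v\<bar>"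
  have "\<bar>(\<Sum>v\<in>V. score s C (x(i := y)) v) - (\<Sum>v\<in>V. score s C x v)\<bar> \<le> (\<Sum>v\<in>V. ?\<Delta> v)"
    unfolding sum_subtractf[symmetric] by (rule sum_abs)
  also have "(\<Sum>v\<in>V. ?\<Delta> v) = (\<Sum>v\<in>?B i. ?\<Delta> v)"
  proof (rule sum.mono_neutral_right[OF finite_V ball_subset_V[OF i]], rule ballI)
    fix v assume "v \<in> V - ?B i"
    then have "i \<notin> ?B v" using ball_sym by blast
    then have "W (x(i := y)) \<inter> ?B v = W x \<inter> ?B v" by (auto simp: W_def)
    from score_local[OF this] show "?\<Delta> v = 0" by simp
  qed
  also have "\<dots> \<le> (\<Sum>v\<in>?B i. real d + 1 + C)"
  proof (rule sum_mono)
    fix v assume "v \<in> ?B i"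
    then have "v \<in> V" using ball_subset_V[OF i] by blast
    from score_range[OF C this, of s x] score_range[OF C this, of s "x(i := y)"]
    show "?\<Delta> v \<le> real d + 1 + C" by linarith
  qed
  also have "\<dots> = real (card (?B i)) * (real d + 1 + C)" by (simp only: sum_constant)
  also have "\<dots> \<le> real ((d + 1) ^ (s + 2)) * (real d + 1 + C)"
  proof (rule mult_right_mono)
    show "real (card (?B i)) \<le> real ((d + 1) ^ (s + 2))"
      unfolding of_nat_le_iff add_2_eq_Suc' by (rule card_ball_le[OF i])
  qed (use C in simp)
  finally show ?thesis .
qed

lemma integrable_config [simp]: "integrable (measure_pmf config) (f :: _ \<Rightarrow> real)"
  by (intro integrable_measure_pmf_finite finite_set_Pi_pmf finite_V finite_q)

lemma expectation_of_bool: "measure_pmf.expectation config (\<lambda>x. of_bool (Q x)) = Pr Q"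
proof -
  have "(\<lambda>x. of_bool (Q x) :: real) = indicator {x. Q x}" by (auto simp: fun_eq_iff indicator_def)
  then show ?thesis by simp
qed

lemma expectation_score:
  "measure_pmf.expectation config (\<lambda>x. score s C x v)
     = Pr (\<lambda>x. full s (W x) v) - (\<Sum>u\<in>N v. Pr (\<lambda>x. fading s (W x) v u))
       + C * Pr (\<lambda>x. \<exists>S\<subseteq>W x \<inter> ball (Suc (Suc s)) v. core S)"
  unfolding score_def
  by (simp add: Bochner_Integration.integral_diff Bochner_Integration.integral_add
      Bochner_Integration.integral_sum expectation_of_bool del: sum_of_bool_eq)

lemma expectation_score_ge:
  assumes v: "v \<in> V" and C: "C \<ge> 0" "C * p ^ ((d + 1) ^ (s + 2)) \<ge> real d + 1"
    and c: "c \<le> 1"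
      "c \<le> p * survival p (d - 1) s ^ d
           - d * (survival p (d - 1) s - survival p (d - 1) (Suc s))"
  shows "c \<le> measure_pmf.expectation config (\<lambda>x. score s C x v)"
proof (cases "\<exists>S\<subseteq>ball (Suc (Suc s)) v. core S")
  case True
  then obtain S where S: "S \<subseteq> ball (Suc (Suc s)) v" "core S" by blast
  have "card S \<le> card (ball (Suc (Suc s)) v)" using S finite_ball by (intro card_mono)
  also have "\<dots> \<le> (d + 1) ^ (s + 2)" using card_ball_le[OF v, of "Suc (Suc s)"] by simp
  finally have card: "card S \<le> (d + 1) ^ (s + 2)" .
  have "p ^ ((d + 1) ^ (s + 2)) \<le> p ^ card S"
    using p_bounds card by (intro power_decreasing) auto
  also have "\<dots> = Pr (\<lambda>x. S \<subseteq> W x)"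
    using Pr_all_open[OF core_subset_V[OF S(2)]] by simp
  also have "\<dots> \<le> Pr (\<lambda>x. \<exists>S\<subseteq>W x \<inter> ball (Suc (Suc s)) v. core S)"
    using S by (intro measure_pmf.finite_measure_mono) auto
  finally have "C * p ^ ((d + 1) ^ (s + 2))
      \<le> C * Pr (\<lambda>x. \<exists>S\<subseteq>W x \<inter> ball (Suc (Suc s)) v. core S)"
    using C by (intro mult_left_mono) auto
  moreover have "(\<Sum>u\<in>N v. Pr (\<lambda>x. fading s (W x) v u)) \<le> (\<Sum>u\<in>N v. 1)"
    by (intro sum_mono) auto
  moreover have "(\<Sum>u\<in>N v. 1 :: real) = d" using card_N[OF v] by simp
  ultimately show ?thesis
    using C(2) c(1) measure_nonneg[of "measure_pmf config" "{x. full s (W x) v}"]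
    unfolding expectation_score by linarith
next
  case False
  have nb: "ball s u \<subseteq> ball (Suc (Suc s)) v \<and> ball (Suc s) u \<subseteq> ball (Suc (Suc s)) v"
    if "u \<in> N v" for u
  proof -
    have "ball s u \<subseteq> ball (Suc s) u" unfolding ball_Suc_right by blast
    moreover have "ball (Suc s) u \<subseteq> ball (Suc (Suc s)) v"
      using that unfolding ball.simps(2)[of "Suc s"] by blast
    ultimately show ?thesis by blast
  qed
  have fading: "Pr (\<lambda>x. fading s (W x) v u) = survival p (d - 1) s - survival p (d - 1) (Suc s)"
    if "u \<in> N v" for u
    using nb[OF that] branch_subset_ball[of s v u] branch_subset_ball[of "Suc s" v u] False
    by (intro Pr_fading that) blast+
  have full: "Pr (\<lambda>x. full s (W x) v) = p * survival p (d - 1) s ^ d"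
  proof (rule Pr_full[OF v])
    fix S assume S: "S \<subseteq> insert v (\<Union>w\<in>N v. branch s v w)"
    have "branch s v w \<subseteq> ball (Suc (Suc s)) v" if "w \<in> N v" for w
      using nb[OF that] branch_subset_ball[of s v w] by blast
    then have "insert v (\<Union>w\<in>N v. branch s v w) \<subseteq> ball (Suc (Suc s)) v"
      by (intro insert_subsetI UN_least ball_refl)
    then have "S \<subseteq> ball (Suc (Suc s)) v" using S by (rule order_trans[rotated])
    then show "\<not> core S" using False by metis
  qed
  have "(\<Sum>u\<in>N v. Pr (\<lambda>x. fading s (W x) v u))
      = d * (survival p (d - 1) s - survival p (d - 1) (Suc s))"
    using fading card_N[OF v] by simp
  moreover have "0 \<le> C * Pr (\<lambda>x. \<exists>S\<subseteq>W x \<inter> ball (Suc (Suc s)) v. core S)"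
    using C(1) by simp
  ultimately show ?thesis
    using c(2) full unfolding expectation_score by linarith
qed

lemma Pr_no_open_core_le:
  assumes d: "d \<ge> 3" and C: "C \<ge> 0" "C * p ^ ((d + 1) ^ (s + 2)) \<ge> real d + 1"
    and c: "0 < c" "c \<le> 1"
      "c \<le> p * survival p (d - 1) s ^ d
           - d * (survival p (d - 1) s - survival p (d - 1) (Suc s))"
    and V: "V \<noteq> {}"
  shows "Pr (\<lambda>x. \<not> (\<exists>S\<subseteq>W x. core S))
       \<le> (real ((d + 1) ^ (s + 2)) * (real d + 1 + C) / c)\<^sup>2 / card V"
proof -
  let ?L = "real ((d + 1) ^ (s + 2)) * (real d + 1 + C)"
  have n: "real (card V) > 0" using V finite_V by (simp add: card_gt_0_iff)
  have "Pr (\<lambda>x. \<not> (\<exists>S\<subseteq>W x. core S)) \<le> Pr (\<lambda>x. (\<Sum>v\<in>V. score s C x v) \<le> 0)"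
  proof (rule measure_pmf.finite_measure_mono)
    show "{x. \<not> (\<exists>S\<subseteq>W x. core S)} \<subseteq> {x. (\<Sum>v\<in>V. score s C x v) \<le> 0}"
      using open_core_if_score_pos[OF d, where s = s and C = C] by (intro Collect_mono) (metis not_le)
  qed simp
  also have "\<dots> \<le> card V * ?L\<^sup>2 / (card V * c)\<^sup>2"
  proof (rule prob_Pi_pmf_nonpos_le[OF finite_V finite_q])
    show "\<bar>(\<Sum>v\<in>V. score s C (x(i := y)) v) - (\<Sum>v\<in>V. score s C x v)\<bar> \<le> ?L" if "i \<in> V" for x i y
      using sum_score_lipschitz[OF C(1) that] .
    have "card V * c = (\<Sum>v\<in>V. c)" by simp
    also have "\<dots> \<le> (\<Sum>v\<in>V. measure_pmf.expectation config (\<lambda>x. score s C x v))"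
      by (intro sum_mono expectation_score_ge C c)
    also have "\<dots> = measure_pmf.expectation config (\<lambda>x. \<Sum>v\<in>V. score s C x v)"
      by (intro Bochner_Integration.integral_sum[symmetric] integrable_config)
    finally show "card V * c \<le> \<dots>" .
  qed (use n c in simp)
  also have "\<dots> = (?L / c)\<^sup>2 / card V"
    unfolding power_mult_distrib power_divide using n by (simp add: power2_eq_square[of "real (card V)"])
  finally show ?thesis .
qed

end

text \<open>
  Above the threshold \<open>1 / (d - 1)\<close> for percolation on the \<open>d\<close>-regular tree, every large \<open>d\<close>-regular
  graph, whatever its structure, is likely to contain an open core.
\<close>

theorem no_open_core_bound:
  fixes q :: "'b pmf"
  assumes d: "d \<ge> 3" and q: "finite (set_pmf q)"
    and supercritical: "measure_pmf.prob q {y. P y} * real (d - 1) > 1"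
  shows "\<exists>K. \<forall>V (N :: 'a \<Rightarrow> 'a set). regular_nbhds V N d \<longrightarrow> V \<noteq> {} \<longrightarrow>
     measure_pmf.prob (Pi_pmf V dflt (\<lambda>_. q)) {x. \<not> (\<exists>S\<subseteq>{i. P (x i)}. regular_nbhds.core N S)}
       \<le> K / card V"
proof -
  define p where "p = measure_pmf.prob q {y. P y}"
  define a where "a = p - 1 / real (d - 1)"
  have p: "0 \<le> p" "p \<le> 1" by (auto simp: p_def)
  have pk: "p * real (d - 1) > 1" using supercritical unfolding p_def .
  have "p > 0" using pk p by (cases "p = 0") auto
  have a: "a > 0" using pk d by (simp add: a_def field_simps)
  have "a \<le> p" by (simp add: a_def)
  define c where "c = p * a ^ d / 2"
  have c: "0 < c" using a \<open>p > 0\<close> by (simp add: c_def)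
  have "p * a ^ d \<le> 1" using p a \<open>a \<le> p\<close> by (intro mult_le_one power_le_one) auto
  then have "c \<le> 1" by (simp add: c_def)
  \<comment> \<open>The depth \<open>s\<close> makes the loss from fading arcs at most half the gain from full vertices.\<close>
  obtain s where s: "survival p (d - 1) s - survival p (d - 1) (Suc s) < c / d"
    using survival_drop_small[OF p(1,2), of "c / d" "d - 1"] c d by auto
  then have "d * (survival p (d - 1) s - survival p (d - 1) (Suc s)) \<le> c"
    using d by (simp add: field_simps)
  moreover have "p * a ^ d \<le> p * survival p (d - 1) s ^ d"
    using survival_ge[OF p(2) pk, of s] p(1) a by (intro mult_left_mono power_mono) (auto simp: a_def)
  ultimately have c': "c \<le> p * survival p (d - 1) s ^ d
      - d * (survival p (d - 1) s - survival p (d - 1) (Suc s))"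
    by (simp add: c_def)
  define C where "C = (real d + 1) / p ^ ((d + 1) ^ (s + 2))"
  have C: "C \<ge> 0" "C * p ^ ((d + 1) ^ (s + 2)) \<ge> real d + 1"
    using \<open>p > 0\<close> by (auto simp: C_def)
  show ?thesis
  proof (intro exI allI impI)
    fix V and N :: "'a \<Rightarrow> 'a set"
    assume VN: "regular_nbhds V N d" "V \<noteq> {}"
    interpret VN: site_percolation V N d q P dflt
      using VN(1) q by (simp add: site_percolation_def site_percolation_axioms_def)
    have "VN.p = p" by (simp add: VN.p_def p_def)
    then show "measure_pmf.prob (Pi_pmf V dflt (\<lambda>_. q))
        {x. \<not> (\<exists>S\<subseteq>{i. P (x i)}. regular_nbhds.core N S)}
      \<le> (real ((d + 1) ^ (s + 2)) * (real d + 1 + C) / c)\<^sup>2 / card V"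
      using VN.Pr_no_open_core_le[OF d, of C s c] C c \<open>c \<le> 1\<close> c' VN(2) by (simp add: VN.W_def)
  qed
qed

section \<open>Monochromatic cores block unanimity\<close>

text \<open>The neighbours of \<open>v\<close>, without \<open>v\<close> itself.\<close>

definition nbhd :: "'a pair_pre_digraph \<Rightarrow> 'a \<Rightarrow> 'a set" where
  "nbhd G v = {j. (v, j) \<in> parcs G}"

lemma out_degree_eq_card_nbhd: "out_degree (with_proj G) v = card (nbhd G v)"
proof -
  have "out_arcs (with_proj G) v = Pair v ` nbhd G v"
    by (auto simp: out_arcs_def nbhd_def)
  then show ?thesis
    by (simp add: out_degree_def card_image inj_on_def)
qed

lemma regular_nbhds_nbhd:
  assumes "regular d G"
  shows "regular_nbhds (pverts G) (nbhd G) d"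
proof -
  interpret pair_graph G using assms by (simp add: regular_def)
  show ?thesis
  proof
    show "finite (pverts G)" by (rule pair_finite_verts)
    show "nbhd G v \<subseteq> pverts G" for v
      by (auto simp: nbhd_def dest: in_arcsD2)
    show "card (nbhd G v) = d" if "v \<in> pverts G" for v
      using assms that by (simp add: regular_def out_degree_eq_card_nbhd)
    show "v \<in> nbhd G u" if "u \<in> nbhd G v" for u v
      using that pair_sym_arcs by (auto simp: nbhd_def symmetric_def dest: symD)
    show "v \<notin> nbhd G v" for v
      using pair_no_loops[of "(v, v)"] by (auto simp: nbhd_def)
  qed
qed

text \<open>
  In a core on which all opinions agree, every vertex sees this opinion at itself and at two of its
  four neighbours, a majority of the five votes.
\<close>

lemma core_persists:
  assumes G: "regular 4 G" and S: "regular_nbhds.core (nbhd G) S"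
    and x: "\<And>j. \<bar>x j\<bar> \<le> 1" and \<sigma>: "\<bar>\<sigma>\<bar> = 1" "\<And>i. i \<in> S \<Longrightarrow> x i = \<sigma>"
  shows "(\<forall>i\<in>S. majority_dynamics G x t i = \<sigma>) \<and> (\<forall>j. \<bar>majority_dynamics G x t j\<bar> \<le> 1)"
proof (induction t)
  case 0
  then show ?case using x \<sigma> by simp
next
  case (Suc t)
  interpret G: regular_nbhds "pverts G" "nbhd G" 4
    using G by (rule regular_nbhds_nbhd)
  let ?y = "majority_dynamics G x t"
  have "(\<Sum>j\<in>majority_nbhd G i. ?y j) * \<sigma> > 0" if i: "i \<in> S" for i
  proof -
    have card: "card (nbhd G i) = 4"
      using i S G.core_subset_V[OF S] by (intro G.card_N) auto
    have M: "majority_nbhd G i = insert i (nbhd G i)"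
      using card by (auto simp: majority_nbhd_def out_degree_eq_card_nbhd nbhd_def)
    obtain a b where ab: "a \<in> nbhd G i" "a \<in> S" "b \<in> nbhd G i" "b \<in> S" "a \<noteq> b"
      using S i unfolding G.core_def by blast
    let ?R = "nbhd G i - {a, b}"
    have "card ?R = 2" using ab card by (simp add: card_Diff_subset)
    have "(\<Sum>j\<in>majority_nbhd G i. ?y j) = ?y i + (\<Sum>j\<in>nbhd G i. ?y j)"
      unfolding M using G.N_irrefl by simp
    also have "(\<Sum>j\<in>nbhd G i. ?y j) = (\<Sum>j\<in>?R. ?y j) + (\<Sum>j\<in>{a, b}. ?y j)"
      using ab by (intro sum.subset_diff) auto
    finally have "(\<Sum>j\<in>majority_nbhd G i. ?y j) = 3 * \<sigma> + (\<Sum>j\<in>?R. ?y j)"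
      using ab i Suc by simp
    moreover have "\<bar>\<Sum>j\<in>?R. ?y j\<bar> \<le> 2"
    proof -
      have "\<bar>\<Sum>j\<in>?R. ?y j\<bar> \<le> (\<Sum>j\<in>?R. \<bar>?y j\<bar>)" by (rule sum_abs)
      also have "\<dots> \<le> (\<Sum>j\<in>?R. 1)" using Suc by (intro sum_mono) auto
      also have "\<dots> = 2" using \<open>card ?R = 2\<close> by simp
      finally show ?thesis .
    qed
    moreover have "\<sigma> = 1 \<or> \<sigma> = - 1" using \<sigma>(1) by arith
    ultimately show ?thesis by (auto simp: abs_le_iff)
  qed
  then have "majority_dynamics G x (Suc t) i = \<sigma>" if "i \<in> S" for i
    using that \<sigma>(1) by (fastforce simp: zero_less_mult_iff sgn_if)
  moreover have "\<bar>majority_dynamics G x (Suc t) j\<bar> \<le> 1" for j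
    by (simp add: sgn_if)
  ultimately show ?case by blast
qed

lemma not_reaches_unanimity:
  assumes G: "regular 4 G" and x: "\<And>j. \<bar>x j\<bar> \<le> 1"
    and S: "regular_nbhds.core (nbhd G) S" "S \<subseteq> {i. x i = 1}"
    and T: "regular_nbhds.core (nbhd G) T" "T \<subseteq> {i. x i = - 1}"
  shows "\<not> reaches_unanimity G x"
proof
  interpret G: regular_nbhds "pverts G" "nbhd G" 4
    using G by (rule regular_nbhds_nbhd)
  assume "reaches_unanimity G x"
  then obtain t where t: "unanimous G (majority_dynamics G x t)"
    by (auto simp: reaches_unanimity_def)
  obtain i j where ij: "i \<in> S" "j \<in> T" using S(1) T(1) unfolding G.core_def by blast
  have "majority_dynamics G x t i = 1" "majority_dynamics G x t j = - 1"
    using core_persists[where x = x and \<sigma> = 1 and t = t, OF G S(1) x]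
      core_persists[where x = x and \<sigma> = "- 1" and t = t, OF G T(1) x] S(2) T(2) ij
    by auto
  moreover have "i \<in> pverts G" "j \<in> pverts G"
    using ij G.core_subset_V S(1) T(1) by blast+
  ultimately show False using t unfolding unanimous_def by (metis one_neq_neg_one)
qed

text \<open>The law of a single initial opinion.\<close>

definition opinion :: "real \<Rightarrow> int pmf" where
  "opinion p = map_pmf (\<lambda>b. if b then 1 else - 1) (bernoulli_pmf p)"

lemma opinion_facts:
  assumes "0 \<le> p" "p \<le> 1"
  shows "measure_pmf.prob (opinion p) {y. y = 1} = p"
    and "measure_pmf.prob (opinion p) {y. y = - 1} = 1 - p"
    and "finite (set_pmf (opinion p))"
    and "set_pmf (opinion p) \<subseteq> {- 1, 1}"
proof -
  let ?f = "\<lambda>b. if b then 1 else - 1 :: int"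
  have f: "?f -` {y. y = 1} = {True}" "?f -` {y. y = - 1} = {False}" by (auto split: if_splits)
  show "measure_pmf.prob (opinion p) {y. y = 1} = p"
    unfolding opinion_def measure_map_pmf f using assms by (simp add: measure_pmf_single)
  show "measure_pmf.prob (opinion p) {y. y = - 1} = 1 - p"
    unfolding opinion_def measure_map_pmf f using assms by (simp add: measure_pmf_single)
  show *: "set_pmf (opinion p) \<subseteq> {- 1, 1}" by (auto simp: opinion_def)
  show "finite (set_pmf (opinion p))" using * by (rule finite_subset) simp
qed

text \<open>
  Open cores are applied twice, with the opinion \<open>1\<close> and with the opinion \<open>-1\<close> playing the role of
  the open state.
\<close>

lemma unanimity_bound:
  assumes p: "1/3 < p" "p < 2/3"
  shows "\<exists>K. \<forall>G :: 'a pair_pre_digraph. regular 4 G \<longrightarrow> pverts G \<noteq> {} \<longrightarrow>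
     measure_pmf.prob (initial_opinions (pverts G) p) {x. reaches_unanimity G x}
       \<le> K / card (pverts G)"
proof -
  let ?q = "opinion p"
  let ?no_core = "\<lambda>\<sigma> (G :: 'a pair_pre_digraph).
    {x. \<not> (\<exists>S\<subseteq>{i. x i = \<sigma>}. regular_nbhds.core (nbhd G) S)}"
  have p01: "0 \<le> p" "p \<le> 1" using p by auto
  note q = opinion_facts[OF p01]
  have "\<exists>K. \<forall>V (N :: 'a \<Rightarrow> 'a set). regular_nbhds V N 4 \<longrightarrow> V \<noteq> {} \<longrightarrow>
     measure_pmf.prob (Pi_pmf V 1 (\<lambda>_. ?q)) {x. \<not> (\<exists>S\<subseteq>{i. x i = 1}. regular_nbhds.core N S)}
       \<le> K / card V"
    using p q by (intro no_open_core_bound) auto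
  then obtain K where K: "\<And>V (N :: 'a \<Rightarrow> 'a set). regular_nbhds V N 4 \<Longrightarrow> V \<noteq> {} \<Longrightarrow>
     measure_pmf.prob (Pi_pmf V 1 (\<lambda>_. ?q)) {x. \<not> (\<exists>S\<subseteq>{i. x i = 1}. regular_nbhds.core N S)}
       \<le> K / card V" by blast
  have "\<exists>K. \<forall>V (N :: 'a \<Rightarrow> 'a set). regular_nbhds V N 4 \<longrightarrow> V \<noteq> {} \<longrightarrow>
     measure_pmf.prob (Pi_pmf V 1 (\<lambda>_. ?q)) {x. \<not> (\<exists>S\<subseteq>{i. x i = - 1}. regular_nbhds.core N S)}
       \<le> K / card V"
    using p q by (intro no_open_core_bound) auto
  then obtain K' where K': "\<And>V (N :: 'a \<Rightarrow> 'a set). regular_nbhds V N 4 \<Longrightarrow> V \<noteq> {} \<Longrightarrow>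
     measure_pmf.prob (Pi_pmf V 1 (\<lambda>_. ?q)) {x. \<not> (\<exists>S\<subseteq>{i. x i = - 1}. regular_nbhds.core N S)}
       \<le> K' / card V" by blast
  show ?thesis
  proof (intro exI allI impI)
    fix G :: "'a pair_pre_digraph"
    assume G: "regular 4 G" "pverts G \<noteq> {}"
    interpret G: regular_nbhds "pverts G" "nbhd G" 4
      using G(1) by (rule regular_nbhds_nbhd)
    let ?P = "Pi_pmf (pverts G) 1 (\<lambda>_. ?q)"
    have P: "initial_opinions (pverts G) p = ?P"
      by (simp add: initial_opinions_def opinion_def)
    have "measure_pmf.prob ?P {x. reaches_unanimity G x}
        \<le> measure_pmf.prob ?P (?no_core 1 G \<union> ?no_core (- 1) G)"
    proof (rule measure_pmf.finite_measure_mono_AE)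
      have "reaches_unanimity G x \<longrightarrow> x \<in> ?no_core 1 G \<union> ?no_core (- 1) G" if "x \<in> set_pmf ?P" for x
      proof -
        have "x \<in> PiE_dflt (pverts G) 1 (set_pmf \<circ> (\<lambda>_. ?q))"
          using that by (simp only: set_Pi_pmf[OF G.finite_V])
        then have pm: "x j \<in> {- 1, 1}" for j
          using q(4) by (cases "j \<in> pverts G") (auto simp: PiE_dflt_def)
        have abs: "\<bar>x j\<bar> \<le> 1" for j
          using pm[of j] by auto
        show ?thesis
        proof (intro impI, rule ccontr)
          assume reaches: "reaches_unanimity G x" and "x \<notin> ?no_core 1 G \<union> ?no_core (- 1) G"
          then obtain S T where
            S: "regular_nbhds.core (nbhd G) S" "S \<subseteq> {i. x i = 1}" and
            T: "regular_nbhds.core (nbhd G) T" "T \<subseteq> {i. x i = - 1}"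
            by auto
          have "\<not> reaches_unanimity G x"
            using G(1) abs S T by (rule not_reaches_unanimity)
          then show False using reaches by contradiction
        qed
      qed
      then show "AE x in measure_pmf ?P. x \<in> {x. reaches_unanimity G x} \<longrightarrow>
          x \<in> ?no_core 1 G \<union> ?no_core (- 1) G"
        by (simp add: AE_measure_pmf_iff)
    qed simp
    also have "\<dots> \<le> measure_pmf.prob ?P (?no_core 1 G) + measure_pmf.prob ?P (?no_core (- 1) G)"
      by (intro measure_Un_le) auto
    also have "\<dots> \<le> K / card (pverts G) + K' / card (pverts G)"
      by (intro add_mono K K' G.regular_nbhds_axioms G(2))
    also have "\<dots> = (K + K') / card (pverts G)" by (simp add: add_divide_distrib)
    finally show "measure_pmf.prob (initial_opinions (pverts G) p) {x. reaches_unanimity G x}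
        \<le> (K + K') / card (pverts G)" unfolding P .
  qed
qed

section \<open>Connected 4-regular graphs of every order\<close>

text \<open>
  The cyclic order on \<open>{..<n}\<close> with steps \<open>1\<close> and \<open>2\<close>, written without modulo.
\<close>

definition circulant :: "nat \<Rightarrow> nat pair_pre_digraph" where
  "circulant n = \<lparr>pverts = {..<n}, parcs = {(i, j). i < n \<and> j < n \<and>
     (\<exists>k\<in>{1, 2}. j = i + k \<or> j + n = i + k \<or> i = j + k \<or> i + n = j + k)}\<rparr>"

lemma circulant_connected_regular:
  assumes n: "n \<ge> 5"
  shows "circulant n \<in> connected_regular_graphs n 4"
proof -
  let ?G = "circulant n"
  have arcs: "(i, j) \<in> parcs ?G \<longleftrightarrow> i < n \<and> j < n \<and>
      (j = i + 1 \<or> j = i + 2 \<or> j + n = i + 1 \<or> j + n = i + 2 \<or>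
       i = j + 1 \<or> i = j + 2 \<or> i + n = j + 1 \<or> i + n = j + 2)" for i j
    by (auto simp: circulant_def)
  have verts: "pverts ?G = {..<n}" by (simp add: circulant_def)
  interpret pair_graph ?G
  proof
    fix e assume "e \<in> parcs ?G"
    then have e: "(fst e, snd e) \<in> parcs ?G" by simp
    then show "fst e \<in> pverts ?G" "snd e \<in> pverts ?G" unfolding arcs verts by simp_all
    show "fst e \<noteq> snd e"
      using e n unfolding arcs by presburger
  next
    show "finite (pverts ?G)" by (simp add: verts)
    have "parcs ?G \<subseteq> {..<n} \<times> {..<n}" by (auto simp: arcs)
    then show "finite (parcs ?G)" by (rule finite_subset) simp
    show "symmetric ?G" by (auto simp: symmetric_def arcs intro!: symI)
  qed
  have "card (nbhd ?G i) = 4" if i: "i < n" for i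
  proof -
    define a where "a = (if i + 1 < n then i + 1 else i + 1 - n)"
    define b where "b = (if i + 2 < n then i + 2 else i + 2 - n)"
    define c where "c = (if 1 \<le> i then i - 1 else i + n - 1)"
    define e where "e = (if 2 \<le> i then i - 2 else i + n - 2)"
    have a: "j < n \<and> (j = i + 1 \<or> j + n = i + 1) \<longleftrightarrow> j = a" for j
      unfolding a_def using i n by (cases "i + 1 < n") auto
    have b: "j < n \<and> (j = i + 2 \<or> j + n = i + 2) \<longleftrightarrow> j = b" for j
      unfolding b_def using i n by (cases "i + 2 < n") auto
    have c: "j < n \<and> (i = j + 1 \<or> i + n = j + 1) \<longleftrightarrow> j = c" for j
      unfolding c_def using i n by (cases "1 \<le> i") auto
    have e: "j < n \<and> (i = j + 2 \<or> i + n = j + 2) \<longleftrightarrow> j = e" for j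
      unfolding e_def using i n by (cases "2 \<le> i") auto
    have "j \<in> nbhd ?G i \<longleftrightarrow> j \<in> {a, b, c, e}" for j
      unfolding nbhd_def mem_Collect_eq arcs insert_iff empty_iff a[symmetric] b[symmetric]
        c[symmetric] e[symmetric]
      using i by blast
    then have "nbhd ?G i = {a, b, c, e}" by blast
    moreover have "a \<noteq> b" unfolding a_def b_def using i n by auto
    moreover have "a \<noteq> c" unfolding a_def c_def using i n by auto
    moreover have "a \<noteq> e" unfolding a_def e_def using i n by auto
    moreover have "b \<noteq> c" unfolding b_def c_def using i n by auto
    moreover have "b \<noteq> e" unfolding b_def e_def using i n by auto
    moreover have "c \<noteq> e" unfolding c_def e_def using i n by auto
    ultimately show ?thesis by simp
  qed
  then have "regular 4 ?G"
    using pair_graph_axioms by (simp add: regular_def verts out_degree_eq_card_nbhd)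
  moreover have "Digraph_Component.connected (with_proj ?G)"
  proof -
    have from0: "0 \<rightarrow>\<^sup>*\<^bsub>with_proj ?G\<^esub> i" if "i < n" for i
      using that
    proof (induction i)
      case 0
      then show ?case using verts by (intro reachable_refl) simp
    next
      case (Suc i)
      then have arc: "(i, Suc i) \<in> parcs ?G" unfolding arcs by simp
      have "0 \<rightarrow>\<^sup>*\<^bsub>with_proj ?G\<^esub> i" using Suc by simp
      from this arc show ?case by (rule reachable_adj_trans)
    qed
    have "u \<rightarrow>\<^sup>*\<^bsub>with_proj ?G\<^esub> v" if "u < n" "v < n" for u v
      using that by (intro reachable_trans[OF symmetric_reachable[OF pair_sym_arcs from0] from0])
    moreover have "0 \<in> pverts ?G" using n by (simp add: verts)
    ultimately show ?thesis
      unfolding Digraph_Component.connected_def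
      by (intro strongly_connectedI reachable_mk_symmetricI) (auto simp only: verts lessThan_iff
          pverts_mk_symmetric with_proj_simps)
  qed
  ultimately show ?thesis by (simp add: connected_regular_graphs_def verts)
qed

lemma random_regular_unanimity_bound:
  assumes "n \<ge> 5" and finite: "finite (set_pmf (opinion p))"
    and K: "\<And>G :: nat pair_pre_digraph. regular 4 G \<Longrightarrow> pverts G = {..<n} \<Longrightarrow>
      measure_pmf.prob (initial_opinions {..<n} p) {x. reaches_unanimity G x} \<le> K"
  shows "measure_pmf.prob (pair_pmf (R n 4) (initial_opinions {..<n} p))
     {(G, x). reaches_unanimity G x} \<le> K"
proof -
  let ?I = "initial_opinions {..<n} p" and ?A = "{(G :: nat pair_pre_digraph, x). reaches_unanimity G x}"
  have set_R: "set_pmf (R n 4) = connected_regular_graphs n 4"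
    unfolding R_def using circulant_connected_regular[OF assms(1)] finite_connected_regular_graphs
    by (intro set_pmf_of_set) auto
  have finR: "finite (set_pmf (R n 4))"
    unfolding set_R by (rule finite_connected_regular_graphs)
  have finI: "finite (set_pmf ?I)"
    unfolding initial_opinions_def opinion_def[symmetric]
    by (intro finite_set_Pi_pmf finite) simp
  have "measure_pmf.prob (pair_pmf (R n 4) ?I) ?A
      = measure_pmf.expectation (pair_pmf (R n 4) ?I) (indicator ?A)"
    by simp
  also have "\<dots> = measure_pmf.expectation (R n 4)
      (\<lambda>G. measure_pmf.expectation ?I (\<lambda>x. indicator ?A (G, x)))"
    by (rule expectation_pair_pmf_finite[OF finR finI])
  also have "(\<lambda>G. measure_pmf.expectation ?I (\<lambda>x. indicator ?A (G, x)))
      = (\<lambda>G. measure_pmf.prob ?I {x. reaches_unanimity G x})"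
  proof
    fix G
    have "(\<lambda>x. indicator ?A (G, x) :: real) = indicator {x. reaches_unanimity G x}"
      by (auto simp: indicator_def fun_eq_iff)
    then show "measure_pmf.expectation ?I (\<lambda>x. indicator ?A (G, x))
        = measure_pmf.prob ?I {x. reaches_unanimity G x}" by simp
  qed
  also have "measure_pmf.expectation (R n 4) \<dots> \<le> measure_pmf.expectation (R n 4) (\<lambda>_. K)"
  proof (rule integral_mono_AE)
    show "AE G in measure_pmf (R n 4). measure_pmf.prob ?I {x. reaches_unanimity G x} \<le> K"
      unfolding AE_measure_pmf_iff set_R using K by (auto simp: connected_regular_graphs_def)
  qed (use finR in \<open>auto intro: integrable_measure_pmf_finite\<close>)
  finally show ?thesis by simp
qed

theorem theorem3:
  fixes p :: real
  assumes "1/3 < p" and "p < 2/3"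
  shows "(\<lambda>n. measure_pmf.prob (pair_pmf (R n 4) (initial_opinions {..<n} p))
             {(G, x). reaches_unanimity G x}) \<longlonglongrightarrow> 0
       \<and> (\<forall>G :: nat \<Rightarrow> 'a pair_pre_digraph.
            expander_sequence 4 G \<and> (\<lambda>n. girth (G n)) \<longlonglongrightarrow> \<infinity> \<longrightarrow>
            (\<lambda>n. measure_pmf.prob (initial_opinions (pverts (G n)) p)
               {x. reaches_unanimity (G n) x}) \<longlonglongrightarrow> 0)"
proof (intro conjI allI impI)
  obtain K where K: "\<And>G :: nat pair_pre_digraph. regular 4 G \<Longrightarrow> pverts G \<noteq> {} \<Longrightarrow>
     measure_pmf.prob (initial_opinions (pverts G) p) {x. reaches_unanimity G x}
       \<le> K / card (pverts G)"
    using unanimity_bound[OF assms] by blast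
  show "(\<lambda>n. measure_pmf.prob (pair_pmf (R n 4) (initial_opinions {..<n} p))
      {(G, x). reaches_unanimity G x}) \<longlonglongrightarrow> 0"
  proof (rule tendsto_sandwich[OF _ _ tendsto_const])
    show "(\<lambda>n. K / real n) \<longlonglongrightarrow> 0" by (rule lim_const_over_n)
    show "\<forall>\<^sub>F n in sequentially. measure_pmf.prob (pair_pmf (R n 4) (initial_opinions {..<n} p))
        {(G, x). reaches_unanimity G x} \<le> K / real n"
      using eventually_ge_at_top[of 5]
    proof eventually_elim
      case (elim n)
      have "measure_pmf.prob (initial_opinions {..<n} p) {x. reaches_unanimity G x} \<le> K / n"
        if "regular 4 G" "pverts G = {..<n}" for G
      proof -
        have "0 \<in> {..<n}" using elim by simp
        then have "pverts G \<noteq> {}" using that(2) by blast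
        from K[OF that(1) this] show ?thesis using that(2) by simp
      qed
      with elim show ?case
        using assms by (intro random_regular_unanimity_bound opinion_facts) auto
    qed
  qed simp
next
  fix G :: "nat \<Rightarrow> 'a pair_pre_digraph"
  assume "expander_sequence 4 G \<and> (\<lambda>n. girth (G n)) \<longlonglongrightarrow> \<infinity>"
  then have G: "\<And>n. regular 4 (G n)"
    and large: "filterlim (\<lambda>n. card (pverts (G n))) at_top sequentially"
    by (auto simp: expander_sequence_def)
  obtain K where K: "\<And>G :: 'a pair_pre_digraph. regular 4 G \<Longrightarrow> pverts G \<noteq> {} \<Longrightarrow>
     measure_pmf.prob (initial_opinions (pverts G) p) {x. reaches_unanimity G x}
       \<le> K / card (pverts G)"
    using unanimity_bound[OF assms] by blast
  show "(\<lambda>n. measure_pmf.prob (initial_opinions (pverts (G n)) p)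
      {x. reaches_unanimity (G n) x}) \<longlonglongrightarrow> 0"
  proof (rule tendsto_sandwich[OF _ _ tendsto_const])
    show "(\<lambda>n. K / real (card (pverts (G n)))) \<longlonglongrightarrow> 0"
      by (rule filterlim_compose[OF lim_const_over_n large])
    show "\<forall>\<^sub>F n in sequentially. measure_pmf.prob (initial_opinions (pverts (G n)) p)
        {x. reaches_unanimity (G n) x} \<le> K / real (card (pverts (G n)))"
      using filterlim_at_top[THEN iffD1, OF large, rule_format, of 1]
    proof eventually_elim
      case (elim n)
      then show ?case by (intro K G) auto
    qed
  qed simp
qed

end
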